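(* Let $\mathbb{F}$ be a field with $\mathrm{char}(\mathbb{F})\neq 2,3$. For every $D\in\mathbb{N}$, the map $$(\alpha_0,\dots,\alpha_D)\mapsto\Big(\sum_{i=0}^D\alpha_ia_i\Big)$$ (the ideal of $\hat{\mathcal{H}}$ generated by $\sum_{i=0}^D\alpha_ia_i$) induces a bijection between the set of ideal-type $(D+1)$-tuples $(\alpha_0,\dots,\alpha_D)\in\mathbb{F}^{D+1}$, taken up to non-zero scalar multiples, and the set of minimal ideals of axial codimension $D$ of $\hat{\mathcal{H}}$.
   Context: Notation: $\mathbb{N}=\{1,2,3,\dots\}$, $3\mathbb{N}=\{3,6,9,\dots\}$; for $r\in\mathbb{Z}$, $\bar r=r+3\mathbb{Z}\in\mathbb{Z}_3$. The algebra $\hat{\mathcal{H}}$ is the commutative $\mathbb{F}$-algebra with basis $\{a_i:i\in\mathbb{Z}\}\cup\{s_j:j\in\mathbb{N}\}\cup\{p_{\bar r,k}:\bar r\in\{\bar1,\bar2\},\ k\in 3\mathbb{N}\}$, where $s_0=0$, $p_{\bar r,j}=0$ for all $\bar r$ whenever $j\notin 3\mathbb{N}$, $p_{\bar 0,j}=-p_{\bar1,j}-p_{\bar2,j}$, $z_{\bar r,j}=p_{\bar r+\bar1,j}-p_{\bar r-\bar1,j}$, and for $i,i'\in\mathbb{Z}$, $j,l\in\mathbb{N}$, $h,k\in3\mathbb{N}$, $\bar r,\bar t\in\mathbb{Z}_3$: (H1) $a_ia_{i'}=\tfrac12(a_i+a_{i'})+s_{|i-i'|}+z_{\bar\imath,|i-i'|}$;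 (H2) $a_is_j=-\tfrac34a_i+\tfrac38(a_{i-j}+a_{i+j})+\tfrac32 s_j-z_{\bar\imath,j}$; (H3) $a_ip_{\bar r,k}=\tfrac32p_{\bar r,k}-p_{-(\bar\imath+\bar r),k}$; (H4) $s_js_l=\tfrac34(s_j+s_l)-\tfrac38(s_{|j-l|}+s_{j+l})$; (H5) $s_jp_{\bar r,k}=\tfrac34(p_{\bar r,j}+p_{\bar r,k})-\tfrac38(p_{\bar r,|j-k|}+p_{\bar r,j+k})$; (H6) $p_{\bar r,h}p_{\bar t,k}=\tfrac14(z_{-(\bar r+\bar t),h}+z_{-(\bar r+\bar t),k})-\tfrac18(z_{-(\bar r+\bar t),|h-k|}+z_{-(\bar r+\bar t),h+k})$. A tuple $(\alpha_0,\dots,\alpha_D)\in\mathbb{F}^{D+1}$ is of ideal type if $\alpha_0\neq0\neq\alpha_D$, $\sum_{i=0}^D\alpha_i=0$, and there is $\epsilon\in\{1,-1\}$ with $\alpha_i=\epsilon\alpha_{D-i}$ for all $i=0,\dots,D$. The axial codimension of an ideal $I$ is the dimension of the subspace of $\hat{\mathcal{H}}/I$ spanned by the images of the $a_i$, $i\in\mathbb{Z}$. An ideal $I$ of axial codimension $D$ has pattern $(\alpha_0,\dots,\alpha_D)$ (with $\alpha_0\neq0\neq\alpha_D$) if $\sum_{i=0}^D\alpha_ia_i\in I$. A minimal ideal of axial codimension $D$ is an ideal of axial codimension $D$ which is minimal with respect to inclusion among the ideals of axial codimension $D$ having the same pattern. *)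

theory Defs
  imports Main
begin

text \<open>Basis indices of the algebra H-hat:
  HA i = a_i (i in Z), HS j = s_j (j >= 1), HP1 k = p_{1,k}, HP2 k = p_{2,k} (k in 3N).\<close>

datatype hidx = HA int | HS nat | HP1 nat | HP2 nat

fun valid_idx :: "hidx \<Rightarrow> bool" where
  "valid_idx (HA i) = True"
| "valid_idx (HS j) = (j \<ge> 1)"
| "valid_idx (HP1 k) = (k > 0 \<and> 3 dvd k)"
| "valid_idx (HP2 k) = (k > 0 \<and> 3 dvd k)"

text \<open>Elements of H-hat: finitely supported coefficient functions on valid indices.\<close>

type_synonym 'a helt = "hidx \<Rightarrow> 'a"

definition supp :: "('a::zero) helt \<Rightarrow> hidx set" where
  "supp v = {x. v x \<noteq> 0}"

definition Hcarrier :: "('a::field) helt set" where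
  "Hcarrier = {v. finite (supp v) \<and> (\<forall>x. \<not> valid_idx x \<longrightarrow> v x = 0)}"

definition hdelta :: "hidx \<Rightarrow> ('a::field) helt" where
  "hdelta x = (\<lambda>y. if y = x then 1 else 0)"

definition hadd :: "('a::field) helt \<Rightarrow> 'a helt \<Rightarrow> 'a helt" where
  "hadd u v = (\<lambda>z. u z + v z)"

definition hsc :: "'a::field \<Rightarrow> 'a helt \<Rightarrow> 'a helt" where
  "hsc c v = (\<lambda>z. c * v z)"

definition hzero :: "('a::field) helt" where
  "hzero = (\<lambda>z. 0)"

definition av :: "int \<Rightarrow> ('a::field) helt" where
  "av i = hdelta (HA i)"

definition sv :: "nat \<Rightarrow> ('a::field) helt" where
  "sv j = (if j = 0 then hzero else hdelta (HS j))"

definition pv :: "int \<Rightarrow> nat \<Rightarrow> ('a::field) helt" where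
  "pv r k = (if k > 0 \<and> 3 dvd k then
      (if r mod 3 = 1 then hdelta (HP1 k)
       else if r mod 3 = 2 then hdelta (HP2 k)
       else hsc (-1) (hadd (hdelta (HP1 k)) (hdelta (HP2 k))))
    else hzero)"

definition zv :: "int \<Rightarrow> nat \<Rightarrow> ('a::field) helt" where
  "zv r j = hadd (pv (r + 1) j) (hsc (-1) (pv (r - 1) j))"

fun pres :: "hidx \<Rightarrow> int" where
  "pres (HP1 k) = 1" | "pres (HP2 k) = 2" | "pres _ = 0"

fun pidx :: "hidx \<Rightarrow> nat" where
  "pidx (HP1 k) = k" | "pidx (HP2 k) = k" | "pidx _ = 0"

definition is_p :: "hidx \<Rightarrow> bool" where
  "is_p x = (\<exists>k. x = HP1 k \<or> x = HP2 k)"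

definition ndist :: "int \<Rightarrow> int \<Rightarrow> nat" where
  "ndist i i' = nat \<bar>i - i'\<bar>"

definition mb_AA :: "int \<Rightarrow> int \<Rightarrow> ('a::field) helt" where
  "mb_AA i i' = (\<lambda>z. (1/2) * (av i z + av i' z) + sv (ndist i i') z + zv i (ndist i i') z)"

definition mb_AS :: "int \<Rightarrow> nat \<Rightarrow> ('a::field) helt" where
  "mb_AS i j = (\<lambda>z. - (3/4) * av i z + (3/8) * (av (i - int j) z + av (i + int j) z)
                     + (3/2) * sv j z - zv i j z)"

definition mb_AP :: "int \<Rightarrow> int \<Rightarrow> nat \<Rightarrow> ('a::field) helt" where
  "mb_AP i r k = (\<lambda>z. (3/2) * pv r k z - pv (- (i + r)) k z)"

definition mb_SS :: "nat \<Rightarrow> nat \<Rightarrow> ('a::field) helt" where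
  "mb_SS j l = (\<lambda>z. (3/4) * (sv j z + sv l z) - (3/8) * (sv (ndist (int j) (int l)) z + sv (j + l) z))"

definition mb_SP :: "nat \<Rightarrow> int \<Rightarrow> nat \<Rightarrow> ('a::field) helt" where
  "mb_SP j r k = (\<lambda>z. (3/4) * (pv r j z + pv r k z)
                     - (3/8) * (pv r (ndist (int j) (int k)) z + pv r (j + k) z))"

definition mb_PP :: "int \<Rightarrow> nat \<Rightarrow> int \<Rightarrow> nat \<Rightarrow> ('a::field) helt" where
  "mb_PP r h t k = (\<lambda>z. (1/4) * (zv (- (r + t)) h z + zv (- (r + t)) k z)
                     - (1/8) * (zv (- (r + t)) (ndist (int h) (int k)) z + zv (- (r + t)) (h + k) z))"

fun mb :: "hidx \<Rightarrow> hidx \<Rightarrow> ('a::field) helt" where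
  "mb (HA i) (HA i') = mb_AA i i'"
| "mb (HA i) (HS j) = mb_AS i j"
| "mb (HS j) (HA i) = mb_AS i j"
| "mb (HA i) (HP1 k) = mb_AP i 1 k"
| "mb (HA i) (HP2 k) = mb_AP i 2 k"
| "mb (HP1 k) (HA i) = mb_AP i 1 k"
| "mb (HP2 k) (HA i) = mb_AP i 2 k"
| "mb (HS j) (HS l) = mb_SS j l"
| "mb (HS j) (HP1 k) = mb_SP j 1 k"
| "mb (HS j) (HP2 k) = mb_SP j 2 k"
| "mb (HP1 k) (HS j) = mb_SP j 1 k"
| "mb (HP2 k) (HS j) = mb_SP j 2 k"
| "mb (HP1 h) (HP1 k) = mb_PP 1 h 1 k"
| "mb (HP1 h) (HP2 k) = mb_PP 1 h 2 k"
| "mb (HP2 h) (HP1 k) = mb_PP 2 h 1 k"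
| "mb (HP2 h) (HP2 k) = mb_PP 2 h 2 k"

definition hmult :: "('a::field) helt \<Rightarrow> 'a helt \<Rightarrow> 'a helt" where
  "hmult u v = (\<lambda>z. \<Sum>x\<in>supp u. \<Sum>y\<in>supp v. u x * v y * mb x y z)"

definition is_ideal :: "('a::field) helt set \<Rightarrow> bool" where
  "is_ideal I \<longleftrightarrow> I \<subseteq> Hcarrier \<and> hzero \<in> I
     \<and> (\<forall>u\<in>I. \<forall>v\<in>I. hadd u v \<in> I)
     \<and> (\<forall>c. \<forall>u\<in>I. hsc c u \<in> I)
     \<and> (\<forall>u\<in>I. \<forall>v\<in>Hcarrier. hmult v u \<in> I)"

definition ideal_gen :: "('a::field) helt \<Rightarrow> 'a helt set" where
  "ideal_gen v = \<Inter> {I. is_ideal I \<and> v \<in> I}"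

definition acomb :: "(int \<Rightarrow> 'a::field) \<Rightarrow> int set \<Rightarrow> 'a helt" where
  "acomb c T = (\<lambda>z. \<Sum>i\<in>T. c i * av i z)"

text \<open>Axial codimension D: the images of the a_i in H-hat/I span a space of dimension D
  (expressed by a basis of D images of a_i's).\<close>
definition axial_codim :: "('a::field) helt set \<Rightarrow> nat \<Rightarrow> bool" where
  "axial_codim I D \<longleftrightarrow> (\<exists>T. finite T \<and> card T = D
      \<and> (\<forall>c. acomb c T \<in> I \<longrightarrow> (\<forall>i\<in>T. c i = 0))
      \<and> (\<forall>k. \<exists>c. hadd (av k) (hsc (-1) (acomb c T)) \<in> I))"

definition pat_vec :: "nat \<Rightarrow> (nat \<Rightarrow> 'a::field) \<Rightarrow> 'a helt" where
  "pat_vec D \<alpha> = (\<lambda>z. \<Sum>i\<in>{0..D}. \<alpha> i * av (int i) z)"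

definition has_pattern :: "('a::field) helt set \<Rightarrow> nat \<Rightarrow> (nat \<Rightarrow> 'a) \<Rightarrow> bool" where
  "has_pattern I D \<alpha> \<longleftrightarrow> axial_codim I D \<and> \<alpha> 0 \<noteq> 0 \<and> \<alpha> D \<noteq> 0 \<and> pat_vec D \<alpha> \<in> I"

definition minimal_ideal :: "('a::field) helt set \<Rightarrow> nat \<Rightarrow> bool" where
  "minimal_ideal I D \<longleftrightarrow> is_ideal I \<and> axial_codim I D \<and>
     (\<exists>\<alpha>. has_pattern I D \<alpha> \<and>
        (\<forall>J. is_ideal J \<and> axial_codim J D \<and> has_pattern J D \<alpha> \<and> J \<subseteq> I \<longrightarrow> J = I))"

definition ideal_type :: "nat \<Rightarrow> (nat \<Rightarrow> 'a::field) \<Rightarrow> bool" where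
  "ideal_type D \<alpha> \<longleftrightarrow> \<alpha> 0 \<noteq> 0 \<and> \<alpha> D \<noteq> 0 \<and> (\<Sum>i\<in>{0..D}. \<alpha> i) = 0
     \<and> (\<exists>\<epsilon>\<in>{1, -1}. \<forall>i\<le>D. \<alpha> i = \<epsilon> * \<alpha> (D - i))"

end

theory Submission
  imports Defs
begin

text \<open>Write \<open>U\<close> for the span of the axes, identified with the Laurent polynomials over the field.
  For \<open>x\<close> in an ideal \<open>I\<close> and in \<open>U\<close>, the double products of \<open>x\<close> with \<open>a\<^sub>j\<close> and \<open>a\<^sub>k\<close>, where
  \<open>k \<equiv> j\<close> modulo \<open>3\<close>, and the product of \<open>x\<close> with \<open>s\<^sub>1\<close> lie in \<open>U\<close> up to known elements of \<open>I\<close>.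
  They show that \<open>I\<close> contains either every axis or only elements of \<open>U\<close> with coefficient sum \<open>0\<close>,
  and that in the second case \<open>I \<inter> U\<close> is an ideal of Laurent polynomials stable under \<open>t \<mapsto> 1/t\<close>.
  If \<open>I\<close> has axial codimension \<open>D\<close>, a pattern of length \<open>D + 1\<close> generates \<open>I \<inter> U\<close>, so it is unique up to
  scalars and of ideal type. Conversely, for a pattern of ideal type the sum of its translates,
  of their images under \<open>a\<^sub>i \<mapsto> s\<close> of index \<open>\<bar>i\<bar>\<close>, and of all \<open>p\<close> is an ideal whose intersection with
  \<open>U\<close> is spanned by the translates; hence the ideal generated by the pattern has axial codimension \<open>D\<close>.\<close>

section \<open>Linear functionals and products\<close>

text \<open>The linear extension of \<open>\<phi>\<close> from the basis. Products are evaluated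
  through such functionals, and the ideal with a prescribed pattern is cut out by them.\<close>

definition linfun :: "(hidx \<Rightarrow> 'a::field) \<Rightarrow> 'a helt \<Rightarrow> 'a" where
  "linfun \<phi> v = (\<Sum>x\<in>supp v. v x * \<phi> x)"

lemma linfun_superset:
  assumes "finite X" "supp v \<subseteq> X"
  shows "linfun \<phi> v = (\<Sum>x\<in>X. v x * \<phi> x)"
  unfolding linfun_def
  by (rule sum.mono_neutral_left) (use assms in \<open>auto simp: supp_def\<close>)

lemma finite_supp_add [simp]:
  fixes u v :: "'a::field helt"
  shows "finite (supp u) \<Longrightarrow> finite (supp v) \<Longrightarrow> finite (supp (\<lambda>z. u z + v z))"
  by (rule finite_subset[of _ "supp u \<union> supp v"]) (auto simp: supp_def)

lemma finite_supp_diff [simp]: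
  fixes u v :: "'a::field helt"
  shows "finite (supp u) \<Longrightarrow> finite (supp v) \<Longrightarrow> finite (supp (\<lambda>z. u z - v z))"
  by (rule finite_subset[of _ "supp u \<union> supp v"]) (auto simp: supp_def)

lemma finite_supp_scale [simp]:
  fixes v :: "'a::field helt"
  shows "finite (supp v) \<Longrightarrow> finite (supp (\<lambda>z. c * v z))"
  by (rule finite_subset[of _ "supp v"]) (auto simp: supp_def)

lemma finite_supp_uminus [simp]:
  fixes v :: "'a::field helt"
  shows "finite (supp v) \<Longrightarrow> finite (supp (\<lambda>z. - v z))"
  by (simp add: supp_def)

lemma finite_supp_divide [simp]:
  fixes v :: "'a::field helt"
  shows "finite (supp v) \<Longrightarrow> finite (supp (\<lambda>z. v z / c))"
  by (rule finite_subset[of _ "supp v"]) (auto simp: supp_def)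

lemma finite_supp_zero [simp]: "finite (supp (\<lambda>z. 0 :: 'a::field))"
  by (simp add: supp_def)

lemma finite_supp_sum [simp]:
  fixes w :: "'i \<Rightarrow> 'a::field helt"
  shows "(\<And>i. i \<in> T \<Longrightarrow> finite (supp (w i))) \<Longrightarrow> finite (supp (\<lambda>z. \<Sum>i\<in>T. w i z))"
  by (induction T rule: infinite_finite_induct) simp_all

lemma linfun_zero [simp]: "linfun \<phi> (\<lambda>z. 0) = 0"
  by (simp add: linfun_def)

lemma linfun_zero_left [simp]: "linfun (\<lambda>x. 0) v = 0"
  by (simp add: linfun_def)

lemma linfun_add [simp]:
  assumes "finite (supp u)" "finite (supp v)"
  shows "linfun \<phi> (\<lambda>z. u z + v z) = linfun \<phi> u + linfun \<phi> v"
  using assms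
  by (subst (1 2 3) linfun_superset[of "supp u \<union> supp v"])
     (auto simp: supp_def algebra_simps sum.distrib)

lemma linfun_scale [simp]:
  assumes "finite (supp v)"
  shows "linfun \<phi> (\<lambda>z. c * v z) = c * linfun \<phi> v"
  using assms
  by (subst (1 2) linfun_superset[of "supp v"]) (auto simp: supp_def algebra_simps sum_distrib_left)

lemma linfun_diff [simp]:
  assumes "finite (supp u)" "finite (supp v)"
  shows "linfun \<phi> (\<lambda>z. u z - v z) = linfun \<phi> u - linfun \<phi> v"
  using assms
  by (subst (1 2 3) linfun_superset[of "supp u \<union> supp v"])
     (auto simp: supp_def algebra_simps sum_subtractf)

lemma linfun_uminus [simp]:
  assumes "finite (supp v)"
  shows "linfun \<phi> (\<lambda>z. - v z) = - linfun \<phi> v"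
  using linfun_scale[OF assms, of \<phi> "-1"] by simp

lemma linfun_divide [simp]:
  assumes "finite (supp v)"
  shows "linfun \<phi> (\<lambda>z. v z / c) = linfun \<phi> v / c"
  using linfun_scale[OF assms, of \<phi> "1 / c"] by simp

lemma linfun_sum [simp]:
  assumes "\<And>i. i \<in> T \<Longrightarrow> finite (supp (w i))"
  shows "linfun \<phi> (\<lambda>z. \<Sum>i\<in>T. w i z) = (\<Sum>i\<in>T. linfun \<phi> (w i))"
  using assms by (induction T rule: infinite_finite_induct) simp_all

lemma finite_supp_hdelta [simp]: "finite (supp (hdelta x))"
  by (simp add: supp_def hdelta_def)

lemma linfun_hdelta [simp]: "linfun \<phi> (hdelta x) = \<phi> x"
  by (simp add: linfun_superset[of "{x}"] supp_def hdelta_def)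

lemma finite_supp_basis [simp]:
  "finite (supp (av i))" "finite (supp (sv j))" "finite (supp (pv r k))" "finite (supp (zv r k))"
  by (simp_all add: av_def sv_def pv_def zv_def hzero_def hadd_def hsc_def)

lemma linfun_av [simp]: "linfun \<phi> (av i) = \<phi> (HA i)"
  by (simp add: av_def)

lemma linfun_sv: "linfun \<phi> (sv j) = (if j = 0 then 0 else \<phi> (HS j))"
  by (simp add: sv_def hzero_def)

lemma linfun_pv:
  "linfun \<phi> (pv r k) = (if k > 0 \<and> 3 dvd k then
      (if r mod 3 = 1 then \<phi> (HP1 k) else if r mod 3 = 2 then \<phi> (HP2 k)
       else - \<phi> (HP1 k) - \<phi> (HP2 k)) else 0)"
  by (simp add: pv_def hzero_def hsc_def hadd_def)

lemma linfun_zv: "linfun \<phi> (zv r k) = linfun \<phi> (pv (r + 1) k) - linfun \<phi> (pv (r - 1) k)"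
  by (simp add: zv_def hsc_def hadd_def)

lemma linfun_add_left: "linfun (\<lambda>x. \<phi> x + \<psi> x) v = linfun \<phi> v + linfun \<psi> v"
  by (simp add: linfun_def algebra_simps sum.distrib)

text \<open>Each coordinate of a product is an iterated linear functional, so linearity in the
  second factor is inherited from \<open>linfun\<close>.\<close>

lemma hmult_linfun: "hmult u v z = linfun (\<lambda>x. linfun (\<lambda>y. mb x y z) v) u"
  by (simp add: hmult_def linfun_def sum_distrib_left mult.assoc)

lemma finite_supp_mb [simp]: "finite (supp (mb x y))"
  by (cases "(x, y)" rule: mb.cases)
    (simp_all add: mb_AA_def mb_AS_def mb_AP_def mb_SS_def mb_SP_def mb_PP_def)

lemma linfun_hmult:
  assumes "finite (supp u)" "finite (supp v)"
  shows "linfun \<phi> (hmult u v) = linfun (\<lambda>x. linfun (\<lambda>y. linfun \<phi> (mb x y)) v) u"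
  using assms unfolding hmult_def
  by (simp add: linfun_def[of _ u] linfun_def[of _ v] sum_distrib_left mult.assoc)

lemma finite_supp_hmult:
  assumes "finite (supp u)" "finite (supp v)"
  shows "finite (supp (hmult u v))"
  using assms unfolding hmult_def by simp

lemma hmult_av_av: "hmult (av k) (av i) = mb_AA k i"
  by (rule ext) (simp add: hmult_linfun)

lemma hmult_av: "hmult (av k) v z = linfun (\<lambda>y. mb (HA k) y z) v"
  by (simp add: hmult_linfun)

section \<open>Products of one axis with \<open>p\<close>, \<open>z\<close> and
  \<open>s\<close>\<close>

lemma pv_cong: "r mod 3 = t mod 3 \<Longrightarrow> pv r k = pv t k"
  by (simp add: pv_def)

lemma zv_cong:
  assumes "r mod 3 = t mod 3" shows "zv r k = zv t k"
proof -
  have "(r + 1) mod 3 = (t + 1) mod 3" "(r - 1) mod 3 = (t - 1) mod 3"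
    using mod_add_cong[OF assms refl, of 1] mod_diff_cong[OF assms refl, of 1] by simp_all
  then show ?thesis by (simp add: zv_def pv_cong[of "r+1" "t+1"] pv_cong[of "r-1" "t-1"])
qed

lemma zv_eq_0: "\<not> 3 dvd k \<Longrightarrow> zv r k z = 0"
  by (simp add: zv_def pv_def hadd_def hsc_def hzero_def)

lemma mod3_cases:
  fixes r :: int
  obtains "r mod 3 = 0" | "r mod 3 = 1" | "r mod 3 = 2"
proof -
  have "r mod 3 = 0 \<or> r mod 3 = 1 \<or> r mod 3 = 2" by presburger
  then show ?thesis by (elim disjE) (rule that; assumption)+
qed

context
  assumes char2: "(2::'a::field) \<noteq> 0" and char3: "(3::'a) \<noteq> 0"
begin

lemma char_not_2_numerals:
  "(4::'a) \<noteq> 0" "(6::'a) \<noteq> 0" "(8::'a) \<noteq> 0"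
proof -
  have "(4::'a) = 2 * 2" "(6::'a) = 2 * 3" "(8::'a) = 2 * 2 * 2" by simp_all
  then show "(4::'a) \<noteq> 0" "(6::'a) \<noteq> 0" "(8::'a) \<noteq> 0"
    using char2 char3 by (metis no_zero_divisors)+
qed

text \<open>Clears denominators: the coefficients become polynomials in one half \<open>h\<close>,
  and identities between them follow from \<open>2 * h = 1\<close> by commutative ring
  reasoning.\<close>

lemma dyadic_fractions:
  obtains h :: 'a where "2 * h = 1" "1/2 = h" "3/2 = 3 * h" "5/2 = 5 * h" "1/4 = h * h" "3/4 = 3 * h * h"
    "3/8 = 3 * h * h * h"
proof
  show "2 * (1/2) = (1::'a)" "1/2 = (1/2::'a)" "3/2 = 3 * (1/2::'a)" "5/2 = 5 * (1/2::'a)"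
    "1/4 = (1/2) * (1/2::'a)" "3/4 = 3 * (1/2) * (1/2::'a)"
    "3/8 = 3 * (1/2) * (1/2) * (1/2::'a)"
    using char2 by simp_all
qed

lemma pv_sum_0: "pv r k z + pv (r + 1) k z + pv (r + 2) k z = (0 :: 'a)"
proof (cases r rule: mod3_cases)
  case 1
  then have "(r + 1) mod 3 = 1" "(r + 2) mod 3 = 2" by presburger+
  with 1 show ?thesis by (simp add: pv_def hzero_def hadd_def hsc_def)
next
  case 2
  then have "(r + 1) mod 3 = 2" "(r + 2) mod 3 = 0" by presburger+
  with 2 show ?thesis by (simp add: pv_def hzero_def hadd_def hsc_def)
next
  case 3
  then have "(r + 1) mod 3 = 0" "(r + 2) mod 3 = 1" by presburger+
  with 3 show ?thesis by (simp add: pv_def hzero_def hadd_def hsc_def)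
qed

lemma hmult_av_pv_nonzero:
  assumes "r mod 3 \<noteq> 0"
  shows "hmult (av k) (pv r n) z = (mb_AP k r n z :: 'a)"
proof (cases r rule: mod3_cases)
  case 1
  with assms show ?thesis by simp
next
  case 2
  then have "(- (k + r)) mod 3 = (- (k + 1)) mod 3" by presburger
  then show ?thesis
    using 2 pv_cong[of r 1 n] pv_cong[of "- (k + r)" "- (k + 1)" n]
    by (auto simp: hmult_av linfun_pv mb_AP_def) (auto simp: pv_def hzero_def)
next
  case 3
  then have "(- (k + r)) mod 3 = (- (k + 2)) mod 3" by presburger
  then show ?thesis
    using 3 pv_cong[of r 2 n] pv_cong[of "- (k + r)" "- (k + 2)" n]
    by (auto simp: hmult_av linfun_pv mb_AP_def) (auto simp: pv_def hzero_def)
qed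

text \<open>(H3) is built into the product for the residues 1 and 2. It extends to residue 0 because
  \<open>- (k + r)\<close> permutes the residues with \<open>r\<close>, and the three
  \<open>p\<close> of one index sum to zero.\<close>

lemma hmult_av_pv: "hmult (av k) (pv r n) z = (mb_AP k r n z :: 'a)"
proof (cases "r mod 3 = 0")
  case True
  then have m: "(r + 1) mod 3 \<noteq> 0" "(r + 2) mod 3 \<noteq> 0" by presburger+
  have "pv r n = (\<lambda>z. - pv (r + 1) n z - pv (r + 2) n z :: 'a)"
    using pv_sum_0[of r n] by (auto simp: fun_eq_iff algebra_simps eq_neg_iff_add_eq_0)
  then have "hmult (av k) (pv r n) z = - hmult (av k) (pv (r + 1) n) z - (hmult (av k) (pv (r + 2) n) z :: 'a)"
    by (simp add: hmult_av)
  also have "\<dots> = mb_AP k r n z"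
  proof -
    have "pv (- (k + (r + 2))) n z + pv (- (k + (r + 1))) n z + pv (- (k + r)) n z = (0 :: 'a)"
      using pv_sum_0[of "- (k + (r + 2))" n z] by (simp add: algebra_simps)
    then have *: "pv (- (k + r)) n z = - pv (- (k + (r + 2))) n z - (pv (- (k + (r + 1))) n z :: 'a)"
      by (simp add: eq_neg_iff_add_eq_0 algebra_simps)
    have **: "pv r n z = - pv (r + 1) n z - (pv (r + 2) n z :: 'a)"
      using pv_sum_0[of r n z] by (simp add: eq_neg_iff_add_eq_0 algebra_simps)
    show ?thesis
      unfolding hmult_av_pv_nonzero[OF m(1)] hmult_av_pv_nonzero[OF m(2)] mb_AP_def * **
      by (simp add: algebra_simps)
  qed
  finally show ?thesis .
qed (rule hmult_av_pv_nonzero)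

text \<open>For \<open>k\<close> congruent to \<open>j\<close>, the second term of (H3) exchanges
  the two \<open>p\<close> whose difference is \<open>zv j n\<close>; this makes
  \<open>zv j n\<close> an eigenvector with eigenvalue 3/2 + 1.\<close>

lemma hmult_av_zv:
  assumes "k mod 3 = j mod 3"
  shows "hmult (av k) (zv j n) = (\<lambda>z. 5/2 * zv j n z :: 'a)"
proof
  fix z
  have "3 dvd k - j" using assms by (simp add: mod_eq_dvd_iff)
  then obtain m where "k - j = 3 * m" by (rule dvdE)
  then have "- (k + (j + 1)) = (j - 1) + 3 * (- j - m)" "- (k + (j - 1)) = (j + 1) + 3 * (- j - m)"
    by simp_all
  then have m: "(- (k + (j + 1))) mod 3 = (j - 1) mod 3" "(- (k + (j - 1))) mod 3 = (j + 1) mod 3"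
    by (simp_all only: mod_mult_self2)
  have "(hmult (av k) (zv j n) z :: 'a) = hmult (av k) (pv (j + 1) n) z - hmult (av k) (pv (j - 1) n) z"
    by (simp add: hmult_av linfun_zv)
  also have "\<dots> = 5/2 * zv j n z"
    using char2 char_not_2_numerals unfolding hmult_av_pv mb_AP_def pv_cong[OF m(1)] pv_cong[OF m(2)]
    by (simp add: zv_def hadd_def hsc_def field_simps)
  finally show "(hmult (av k) (zv j n) z :: 'a) = 5/2 * zv j n z" .
qed

text \<open>Beyond the basis rule this includes \<open>n = 0\<close>, where the axis terms of (H2)
  cancel; that case arises for two equal axes.\<close>

lemma hmult_av_sv: "hmult (av k) (sv n) = (mb_AS k n :: 'a helt)"
proof
  fix z
  show "hmult (av k) (sv n) z = (mb_AS k n z :: 'a)"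
    using char2 char_not_2_numerals
    by (auto simp: hmult_av linfun_sv mb_AS_def sv_def zv_def pv_def hzero_def hadd_def hsc_def field_simps)
qed

text \<open>The \<open>s\<close> and \<open>p\<close> components that depend on \<open>i\<close> cancel.\<close>

lemma hmult_av_hmult_av:
  assumes "k mod 3 = j mod 3"
  shows "hmult (av k) (hmult (av j) (av i)) z - 1/2 * hmult (av k) (av i) z
       - 3/2 * hmult (av j) (av i) z + 3/4 * av i z =
     (1/2 * hmult (av k) (av j) z - 3/4 * (av k z + av j z)
       + 3/8 * (av (k + i - j) z + av (k - i + j) z) :: 'a)"
proof -
  define n where "n = ndist j i"
  \<comment> \<open>Whichever sign \<open>i - j\<close> has, the same unordered pair of axes
    arises.\<close>
  have *: "av (k - int n) z + av (k + int n) z = (av (k + i - j) z + av (k - i + j) z :: 'a)"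
    by (cases "i \<le> j") (simp_all add: n_def ndist_def algebra_simps)
  have ji: "hmult (av j) (av i) = (\<lambda>z. 1/2 * (av j z + av i z) + sv n z + zv j n z :: 'a)"
    by (simp add: hmult_av_av mb_AA_def n_def)
  have "hmult (av k) (hmult (av j) (av i)) z = 1/2 * (hmult (av k) (av j) z + hmult (av k) (av i) z)
     + hmult (av k) (sv n) z + (hmult (av k) (zv j n) z :: 'a)"
    unfolding ji by (simp add: hmult_av)
  moreover have "hmult (av k) (sv n) z = - (3/4) * av k z + 3/8 * (av (k + i - j) z + av (k - i + j) z)
     + 3/2 * sv n z - (zv j n z :: 'a)"
    by (simp only: hmult_av_sv mb_AS_def * zv_cong[OF assms])
  moreover have "hmult (av j) (av i) z = 1/2 * (av j z + av i z) + sv n z + (zv j n z :: 'a)"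
    by (simp add: ji)
  moreover obtain h :: 'a where "2 * h = 1"
    and h: "1/2 = h" "3/2 = 3 * h" "5/2 = 5 * h" "1/4 = h * h" "3/4 = 3 * h * h"
      "3/8 = 3 * h * h * h"
    by (rule dyadic_fractions)
  ultimately show ?thesis
    unfolding hmult_av_zv[OF assms] h by algebra
qed

end

section \<open>Ideals and the axes\<close>

lemma hmult_sum_right:
  assumes "\<And>i. i \<in> T \<Longrightarrow> finite (supp (w i))"
  shows "hmult u (\<lambda>z. \<Sum>i\<in>T. c i * w i z) = (\<lambda>z. \<Sum>i\<in>T. c i * hmult u (w i) z)"
proof (cases "finite T")
  case True
  have "hmult u (\<lambda>z. \<Sum>i\<in>T. c i * w i z) z = (\<Sum>i\<in>T. c i * hmult u (w i) z)" for z
    unfolding hmult_linfun using assms True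
    by (simp add: linfun_def[of _ u] sum_distrib_left sum.swap[of _ T] algebra_simps)
  then show ?thesis by auto
qed (simp add: hmult_linfun[abs_def] linfun_def)

lemma av_carrier: "av i \<in> Hcarrier"
  using finite_supp_basis(1)[of i] by (auto simp: Hcarrier_def av_def hdelta_def)

lemma sv_carrier: "sv j \<in> Hcarrier"
  using finite_supp_basis(2)[of j] by (auto simp: Hcarrier_def sv_def hdelta_def hzero_def)

text \<open>Shifts and reflections of a combination change \<open>f\<close> alone and leave
  \<open>c\<close> fixed. Values of \<open>f\<close> may repeat; the coefficient sum is
  \<open>sum c T\<close> in any case.\<close>

definition axis_comb :: "('i \<Rightarrow> 'a::field) \<Rightarrow> ('i \<Rightarrow> int) \<Rightarrow> 'i set \<Rightarrow> 'a helt" where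
  "axis_comb c f T = (\<lambda>z. \<Sum>i\<in>T. c i * av (f i) z)"

lemma hmult_axis_comb: "hmult u (axis_comb c f T) = (\<lambda>z. \<Sum>i\<in>T. c i * hmult u (av (f i)) z)"
  unfolding axis_comb_def by (rule hmult_sum_right) simp

lemma acomb_single:
  assumes "finite W" "i \<in> W"
  shows "acomb (\<lambda>k. if k = i then 1 else 0) W = av i"
proof
  fix z
  have "acomb (\<lambda>k. if k = i then 1 else 0) W z = (\<Sum>k\<in>W. if k = i then av i z else 0)"
    unfolding acomb_def by (rule sum.cong) auto
  then show "acomb (\<lambda>k. if k = i then 1 else 0) W z = av i z"
    using assms by simp
qed

section \<open>Reflections and shifts inside an ideal\<close>

locale highwater_ideal =
  fixes I :: "'a::field helt set"
  assumes ideal: "is_ideal I" and char2: "(2::'a) \<noteq> 0" and char3: "(3::'a) \<noteq> 0"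
begin

lemma zero_mem: "(\<lambda>z. 0) \<in> I"
  using ideal by (simp add: is_ideal_def hzero_def)

lemma add_mem: "u \<in> I \<Longrightarrow> v \<in> I \<Longrightarrow> (\<lambda>z. u z + v z) \<in> I"
  using ideal by (auto simp: is_ideal_def hadd_def)

lemma scale_mem: "u \<in> I \<Longrightarrow> (\<lambda>z. c * u z) \<in> I"
  using ideal by (auto simp: is_ideal_def hsc_def)

lemma diff_mem: "u \<in> I \<Longrightarrow> v \<in> I \<Longrightarrow> (\<lambda>z. u z - v z) \<in> I"
  using add_mem[OF _ scale_mem[of v "-1"]] by simp

lemma sum_mem: "(\<And>i. i \<in> T \<Longrightarrow> w i \<in> I) \<Longrightarrow> (\<lambda>z. \<Sum>i\<in>T. c i * w i z) \<in> I"
proof (induction T rule: infinite_finite_induct)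
  case (insert i T)
  then show ?case using add_mem[OF scale_mem[of "w i" "c i"]] by simp
qed (simp_all add: zero_mem)

lemma mult_mem: "u \<in> I \<Longrightarrow> v \<in> Hcarrier \<Longrightarrow> hmult v u \<in> I"
  using ideal by (auto simp: is_ideal_def)

lemma scale_mem_iff: "c \<noteq> 0 \<Longrightarrow> (\<lambda>z. c * u z) \<in> I \<longleftrightarrow> u \<in> I"
  using scale_mem[of "\<lambda>z. c * u z" "1 / c"] scale_mem[of u c] by auto

text \<open>Sums \<open>hmult_av_hmult_av\<close> over the axes of \<open>x\<close>: the terms
  independent of \<open>i\<close> collect the coefficient sum, and the others form a translate and a
  reflection of \<open>x\<close>.\<close>

lemma double_axis_mult_mem:
  assumes x: "axis_comb c f T \<in> I" and kj: "k mod 3 = j mod 3"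
  shows "(\<lambda>z. sum c T * (1/2 * hmult (av k) (av j) z - 3/4 * (av k z + av j z))
     + 3/8 * (axis_comb c (\<lambda>i. k - j + f i) T z + axis_comb c (\<lambda>i. k + j - f i) T z)) \<in> I" (is "?y \<in> I")
proof -
  let ?x = "axis_comb c f T"
  have "(\<lambda>z. hmult (av k) (hmult (av j) ?x) z - 1/2 * hmult (av k) ?x z
       - 3/2 * hmult (av j) ?x z + 3/4 * ?x z) \<in> I" (is "?v \<in> I")
    by (intro add_mem diff_mem scale_mem mult_mem x av_carrier)
  also have "?v = ?y"
  proof
    fix z
    have "?v z = (\<Sum>i\<in>T. c i * (hmult (av k) (hmult (av j) (av (f i))) z
       - 1/2 * hmult (av k) (av (f i)) z - 3/2 * hmult (av j) (av (f i)) z + 3/4 * av (f i) z))"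
      unfolding hmult_axis_comb
      by (subst hmult_sum_right)
        (simp_all add: axis_comb_def finite_supp_hmult sum_distrib_left sum.distrib sum_subtractf algebra_simps)
    also have "\<dots> = (\<Sum>i\<in>T. c i * (1/2 * hmult (av k) (av j) z - 3/4 * (av k z + av j z)
       + 3/8 * (av (k - j + f i) z + av (k + j - f i) z)))"
      unfolding hmult_av_hmult_av[OF char2 char3 kj] by (simp add: algebra_simps)
    also have "\<dots> = ?y z"
      unfolding axis_comb_def sum_distrib_right sum_distrib_left sum.distrib[symmetric]
      by (intro sum.cong refl) (simp only: distrib_left ac_simps)
    finally show "?v z = ?y z" .
  qed
  finally show ?thesis .
qed

text \<open>The case \<open>k = j\<close>: the translate is \<open>x\<close> itself and can be
  subtracted, and since \<open>av j\<close> is idempotent its coefficient is 1/2 - 3/2 = -1.\<close>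

lemma reflect_mem_aux:
  assumes "axis_comb c f T \<in> I"
  shows "(\<lambda>z. 3/8 * axis_comb c (\<lambda>i. 2 * j - f i) T z - sum c T * av j z) \<in> I"
proof -
  have "hmult (av j) (av j) z = (av j z :: 'a)" for z
    using char2 by (simp add: hmult_av_av mb_AA_def ndist_def sv_def hzero_def zv_def pv_def hadd_def hsc_def)
  then have eq: "1/2 * hmult (av j) (av j) z - 3/4 * (av j z + av j z) = (- av j z :: 'a)" for z
    using char2 char_not_2_numerals[OF char2 char3] by (simp add: field_simps)
  show ?thesis
    using diff_mem[OF double_axis_mult_mem[OF assms refl, of j] scale_mem[OF assms, of "3/8"]]
    unfolding eq by (simp add: algebra_simps mult_2)
qed

text \<open>Applies \<open>reflect_mem_aux\<close> twice about the same \<open>j\<close>. The two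
  reflections cancel, so the outcome is 9/64 of \<open>x\<close> plus a multiple of
  \<open>av j\<close>, namely 5/8 - 3/8 = 1/4 times the coefficient sum.\<close>

lemma augmentation_mem:
  assumes "finite T" and x: "axis_comb c f T \<in> I"
  shows "(\<lambda>z. sum c T * av j z) \<in> I"
proof -
  define y where "y = (\<lambda>z. 3/8 * axis_comb c (\<lambda>i. 2 * j - f i) T z - sum c T * av j z)"
  \<comment> \<open>The index \<open>None\<close> carries the extra axis \<open>av j\<close>, so
    that \<open>y\<close> is again a combination of axes.\<close>
  define d where "d = case_option (- sum c T) (\<lambda>i. 3/8 * c i)"
  define g where "g = case_option j (\<lambda>i. 2 * j - f i)"
  define S where "S = insert None (Some ` T)"
  have S: "(\<Sum>i\<in>S. F i) = F None + (\<Sum>i\<in>T. F (Some i))" for F :: "_ \<Rightarrow> 'a"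
    using \<open>finite T\<close> by (subst S_def, subst sum.insert) (auto simp: sum.reindex)
  have "axis_comb d g S = y"
    by (simp add: axis_comb_def S d_def g_def y_def sum_distrib_left algebra_simps)
  then have "axis_comb d g S \<in> I"
    using reflect_mem_aux[OF x, of j] by (simp add: y_def)
  from reflect_mem_aux[OF this, of j]
  have "(\<lambda>z. 3/8 * axis_comb d (\<lambda>i. 2 * j - g i) S z - sum d S * av j z) \<in> I" .
  \<comment> \<open>The factor 9/64 is the square of the factor 3/8 picked up at each
    reflection.\<close>
  from diff_mem[OF this scale_mem[OF x, of "9/64"]]
  have "(\<lambda>z. 3/8 * axis_comb d (\<lambda>i. 2 * j - g i) S z - sum d S * av j z
      - 9/64 * axis_comb c f T z) \<in> I" .
  also have "(\<lambda>z. 3/8 * axis_comb d (\<lambda>i. 2 * j - g i) S z - sum d S * av j z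
      - 9/64 * axis_comb c f T z) = (\<lambda>z. 1/4 * (sum c T * av j z))"
  proof
    fix z
    obtain h :: 'a where h2: "2 * h = 1"
      and h: "1/2 = h" "3/2 = 3 * h" "5/2 = 5 * h" "1/4 = h * h" "3/4 = 3 * h * h"
        "3/8 = 3 * h * h * h"
      by (rule dyadic_fractions[OF char2 char3])
    have h9: "9/64 = (3 * h * h * h) * (3 * h * h * h)"
      unfolding h[symmetric] by simp
    have "axis_comb d (\<lambda>i. 2 * j - g i) S z = - sum c T * av j z + 3/8 * axis_comb c f T z"
      by (simp add: axis_comb_def S d_def g_def sum_distrib_left algebra_simps)
    moreover have "sum d S = - sum c T + 3/8 * sum c T"
      by (simp add: S d_def sum_distrib_left)
    ultimately show "3/8 * axis_comb d (\<lambda>i. 2 * j - g i) S z - sum d S * av j z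
      - 9/64 * axis_comb c f T z = 1/4 * (sum c T * av j z)"
      using h2 unfolding h h9 by algebra
  qed
  finally show ?thesis
    using char_not_2_numerals[OF char2 char3] by (subst (asm) scale_mem_iff) auto
qed

text \<open>Otherwise \<open>augmentation_mem\<close> would put a nonzero multiple of
  \<open>av j\<close> into \<open>I\<close>.\<close>

lemma augmentation_eq_0:
  assumes "finite T" "axis_comb c f T \<in> I" "av j \<notin> I"
  shows "sum c T = 0"
  using augmentation_mem[OF assms(1,2), of j] assms(3) scale_mem_iff[of "sum c T" "av j"] by auto

lemma reflect_mem:
  assumes "finite T" "axis_comb c f T \<in> I"
  shows "axis_comb c (\<lambda>i. 2 * j - f i) T \<in> I"
proof -
  have "(\<lambda>z. 3/8 * axis_comb c (\<lambda>i. 2 * j - f i) T z) \<in> I"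
    using add_mem[OF reflect_mem_aux[OF assms(2)] augmentation_mem[OF assms], of j j] by simp
  then show ?thesis
    using char3 char_not_2_numerals[OF char2 char3] by (subst (asm) scale_mem_iff) auto
qed

text \<open>Multiplication by \<open>sv 1\<close>: in (H2) the \<open>z\<close> term vanishes
  because 3 does not divide 1, and the \<open>s\<close> term is multiplied by the coefficient
  sum.\<close>

lemma shift_sym_mem:
  assumes "sum c T = 0" and x: "axis_comb c f T \<in> I"
  shows "(\<lambda>z. axis_comb c (\<lambda>i. f i - 1) T z + axis_comb c (\<lambda>i. f i + 1) T z) \<in> I" (is "?y \<in> I")
proof -
  have eq: "hmult (sv 1) (av i) z + 3/4 * av i z = 3/8 * (av (i - 1) z + av (i + 1) z)
      + 3/2 * (sv 1 z :: 'a)" for i z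
    by (simp add: hmult_linfun linfun_sv mb_AS_def zv_eq_0)
  have "hmult (sv 1) (axis_comb c f T) z + 3/4 * axis_comb c f T z = 3/8 * ?y z" for z
  proof -
    have "hmult (sv 1) (axis_comb c f T) z + 3/4 * axis_comb c f T z
        = (\<Sum>i\<in>T. c i * (hmult (sv 1) (av (f i)) z + 3/4 * av (f i) z))"
      unfolding hmult_axis_comb unfolding axis_comb_def
      by (simp add: sum_distrib_left sum.distrib algebra_simps)
    also have "\<dots> = 3/8 * ?y z + 3/2 * sum c T * sv 1 z"
      unfolding eq axis_comb_def sum_distrib_left sum_distrib_right sum.distrib[symmetric]
      by (simp only: distrib_left ac_simps)
    finally show ?thesis using assms(1) by simp
  qed
  moreover have "(\<lambda>z. hmult (sv 1) (axis_comb c f T) z + 3/4 * axis_comb c f T z) \<in> I"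
    by (intro add_mem scale_mem mult_mem x sv_carrier)
  ultimately have "(\<lambda>z. 3/8 * ?y z) \<in> I"
    by (simp only:)
  then show ?thesis
    using char3 char_not_2_numerals[OF char2 char3] by (subst (asm) scale_mem_iff) auto
qed

text \<open>The reflections give the shifts by \<open>2\<close>; a reflection combined with \<open>k = j + 3\<close> in the double
  product gives \<open>f + 3\<close> modulo \<open>f + 1\<close>, and \<open>s\<^sub>1\<close> gives \<open>f + 3\<close> modulo \<open>- (f + 1)\<close>.\<close>

lemma shift_mem:
  assumes T: "finite T" and x: "axis_comb c f T \<in> I" and "av j\<^sub>0 \<notin> I"
  shows "axis_comb c (\<lambda>i. f i + m) T \<in> I"
proof -
  have refl: "axis_comb c (\<lambda>i. 2 * j - g i) T \<in> I" if "axis_comb c g T \<in> I" for g j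
    using that by (rule reflect_mem[OF T])
  have sum0: "sum c T = 0"
    using augmentation_eq_0[OF T x] assms(3) by blast
  have two: "axis_comb c (\<lambda>i. g i + 2 * l) T \<in> I" if "axis_comb c g T \<in> I" for g l
    using refl[OF refl[OF that, of 0], of l] by (simp add: algebra_simps)
  have triple: "(\<lambda>z. axis_comb c (\<lambda>i. 3 + g i) T z + axis_comb c (\<lambda>i. 2 * j + 3 - g i) T z) \<in> I"
    if "axis_comb c g T \<in> I" for g j
  proof -
    have "(\<lambda>z. 3/8 * (axis_comb c (\<lambda>i. 3 + g i) T z + axis_comb c (\<lambda>i. 2 * j + 3 - g i) T z)) \<in> I"
      using double_axis_mult_mem[OF that, of "j + 3" j] sum0 by (simp add: algebra_simps)
    then show ?thesis
      using char3 char_not_2_numerals[OF char2 char3] by (subst (asm) scale_mem_iff) auto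
  qed
  have one: "axis_comb c (\<lambda>i. g i + 1) T \<in> I" if g: "axis_comb c g T \<in> I" for g
  proof -
    have "axis_comb c (\<lambda>i. - g i) T \<in> I" using refl[OF g, of 0] by simp
    \<comment> \<open>Both instances contain the combination of the axes \<open>3 - g i\<close>,
      which cancels.\<close>
    from diff_mem[OF triple[OF this, of 0] triple[OF this, of "-1"]]
    have "(\<lambda>z. axis_comb c (\<lambda>i. g i + 3) T z - axis_comb c (\<lambda>i. g i + 1) T z) \<in> I"
      by (simp add: algebra_simps)
    from diff_mem[OF shift_sym_mem[OF sum0 two[OF g, of 1]] this]
    have "(\<lambda>z. 2 * axis_comb c (\<lambda>i. g i + 1) T z) \<in> I"
      by (simp add: algebra_simps)
    then show ?thesis by (simp add: scale_mem_iff char2)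
  qed
  have even: "axis_comb c (\<lambda>i. f i + 2 * (m div 2)) T \<in> I"
    by (rule two[OF x])
  show ?thesis
  proof (cases "even m")
    case True
    then show ?thesis using even by simp
  next
    case False
    then have "(\<lambda>i. f i + m) = (\<lambda>i. f i + 2 * (m div 2) + 1)" by (intro ext) presburger
    then show ?thesis using one[OF even] by (simp only:)
  qed
qed

section \<open>Spanning the axes modulo an ideal\<close>

definition reducible :: "int set \<Rightarrow> 'a helt \<Rightarrow> bool" where
  "reducible W u \<longleftrightarrow> (\<exists>c. (\<lambda>z. u z - acomb c W z) \<in> I)"

lemma reducible_av:
  assumes "finite W" "i \<in> W"
  shows "reducible W (av i)"
proof -
  have "(\<lambda>z. av i z - acomb (\<lambda>k. if k = i then 1 else 0) W z) \<in> I"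
    by (simp add: acomb_single[OF assms] zero_mem)
  then show ?thesis unfolding reducible_def by blast
qed

lemma reducible_sum:
  assumes "\<And>i. i \<in> S \<Longrightarrow> reducible W (w i)"
  shows "reducible W (\<lambda>z. \<Sum>i\<in>S. d i * w i z)"
proof -
  obtain c where c: "\<And>i. i \<in> S \<Longrightarrow> (\<lambda>z. w i z - acomb (c i) W z) \<in> I"
    using assms unfolding reducible_def by metis
  have "(\<lambda>z. \<Sum>i\<in>S. d i * (w i z - acomb (c i) W z)) \<in> I"
    by (rule sum_mem) (rule c)
  also have "(\<lambda>z. \<Sum>i\<in>S. d i * (w i z - acomb (c i) W z)) =
     (\<lambda>z. (\<Sum>i\<in>S. d i * w i z) - acomb (\<lambda>k. \<Sum>i\<in>S. d i * c i k) W z)"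
    by (simp add: acomb_def algebra_simps sum_subtractf sum_distrib_left sum_distrib_right sum.swap[of _ S W])
  finally show ?thesis unfolding reducible_def by blast
qed

lemma reducible_diff_mem:
  assumes "reducible W u" "(\<lambda>z. v z - u z) \<in> I"
  shows "reducible W v"
  using assms(1) add_mem[OF assms(2)] unfolding reducible_def by force

text \<open>The relation \<open>x\<close> is solved for the axis at \<open>p\<close>, whose
  coefficient is invertible.\<close>

lemma reducible_isolate:
  assumes T: "finite T" and x: "axis_comb c f T \<in> I" and p: "p \<in> T" "c p \<noteq> 0"
    and others: "\<And>i. i \<in> T - {p} \<Longrightarrow> reducible W (av (f i))"
  shows "reducible W (av (f p))"
proof (rule reducible_diff_mem)
  show "reducible W (\<lambda>z. \<Sum>i\<in>T - {p}. - c i / c p * av (f i) z)"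
    by (rule reducible_sum) (rule others)
  have "(\<lambda>z. 1 / c p * axis_comb c f T z) \<in> I"
    by (rule scale_mem) (rule x)
  also have "(\<lambda>z. 1 / c p * axis_comb c f T z) =
      (\<lambda>z. av (f p) z - (\<Sum>i\<in>T - {p}. - c i / c p * av (f i) z))"
    using p by (simp add: axis_comb_def sum.remove[OF T p(1)] sum_negf sum_distrib_left algebra_simps sum_divide_distrib)
  finally show "(\<lambda>z. av (f p) z - (\<Sum>i\<in>T - {p}. - c i / c p * av (f i) z)) \<in> I" .
qed

text \<open>A shifted pattern expresses the axis just right of a window through axes inside it,
  since \<open>\<alpha> D \<noteq> 0\<close>, and likewise on the left, since
  \<open>\<alpha> 0 \<noteq> 0\<close>. Induction widens the window by one at both ends.\<close>

lemma window_spans: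
  assumes ends: "\<alpha> 0 \<noteq> 0" "\<alpha> D \<noteq> 0"
    and shifts: "\<And>m. axis_comb \<alpha> (\<lambda>i. int i + m) {0..D} \<in> I"
  shows "reducible {0..<int D} (av k)"
proof -
  have "\<forall>i. - int n \<le> i \<and> i < int D + int n \<longrightarrow> reducible {0..<int D} (av i)" for n
  proof (induction n)
    case 0
    show ?case by (auto intro: reducible_av)
  next
    case (Suc n)
    have top: "reducible {0..<int D} (av (int D + int n))"
      by (rule reducible_isolate[OF _ shifts[of "int n"], of D]) (use ends Suc in auto)
    have "reducible {0..<int D} (av (int 0 + (- int n - 1)))"
    proof (rule reducible_isolate[OF _ shifts[of "- int n - 1"], of 0])
      fix i assume "i \<in> {0..D} - {0}"
      then show "reducible {0..<int D} (av (int i + (- int n - 1)))"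
        using Suc by auto
    qed (use ends in auto)
    then have bot: "reducible {0..<int D} (av (- int n - 1))"
      by simp
    show ?case
    proof (intro allI impI)
      fix i assume "- int (Suc n) \<le> i \<and> i < int D + int (Suc n)"
      then have "i = - int n - 1 \<or> i = int D + int n \<or> - int n \<le> i \<and> i < int D + int n"
        by auto
      then show "reducible {0..<int D} (av i)"
        using bot top Suc.IH by (elim disjE) simp_all
    qed
  qed
  \<comment> \<open>The upper bound of the window is strict; the \<open>+ 1\<close> takes care of
    \<open>D = 0\<close>.\<close>
  from spec[OF this[of "nat \<bar>k\<bar> + 1"], of k] show ?thesis
    by (auto simp: abs_if split: if_splits)
qed

end

text \<open>Gaussian elimination: the equation at \<open>s\<close> is solved for an unknown
  \<open>k0\<close> with nonzero coefficient, and \<open>m'\<close> is the system left for the other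
  unknowns.\<close>

lemma homogeneous_system_nontrivial:
  fixes m :: "'i \<Rightarrow> 'j \<Rightarrow> 'a::field"
  assumes "finite S" "finite T" "card S < card T"
  shows "\<exists>c. (\<exists>k\<in>T. c k \<noteq> 0) \<and> (\<forall>s\<in>S. (\<Sum>k\<in>T. c k * m k s) = 0)"
  using assms
proof (induction S arbitrary: T m rule: finite_induct)
  case empty
  then obtain k where "k \<in> T" by fastforce
  then show ?case by (intro exI[of _ "\<lambda>_. 1"]) auto
next
  case (insert s S)
  show ?case
  proof (cases "\<forall>k\<in>T. m k s = 0")
    case True
    then show ?thesis using insert.IH[of T m] insert by auto
  next
    case False
    then obtain k0 where k0: "k0 \<in> T" "m k0 s \<noteq> 0" by auto
    define m' where "m' k r = m k r - m k s / m k0 s * m k0 r" for k r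
    have "card S < card (T - {k0})" using insert k0 by simp
    then obtain c where c: "\<exists>k\<in>T - {k0}. c k \<noteq> 0" "\<forall>r\<in>S. (\<Sum>k\<in>T - {k0}. c k * m' k r) = 0"
      using insert.IH[of "T - {k0}" m'] insert.prems by auto
    \<comment> \<open>This value of the unknown \<open>k0\<close> makes the equation at
      \<open>s\<close> hold.\<close>
    define c0 where "c0 = - (\<Sum>k\<in>T - {k0}. c k * m k s) / m k0 s"
    define c' where "c' = c(k0 := c0)"
    have split: "(\<Sum>k\<in>T. c' k * m k r) = c0 * m k0 r + (\<Sum>k\<in>T - {k0}. c k * m k r)" for r
    proof -
      have "(\<Sum>k\<in>T - {k0}. c' k * m k r) = (\<Sum>k\<in>T - {k0}. c k * m k r)"
        by (rule sum.cong) (auto simp: c'_def)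
      then show ?thesis
        by (subst sum.remove[OF insert.prems(1) k0(1)]) (simp add: c'_def)
    qed
    have "(\<Sum>k\<in>T. c' k * m k r) = 0" if "r \<in> S" for r
    proof -
      have "(\<Sum>k\<in>T - {k0}. c k * m' k r) = (\<Sum>k\<in>T - {k0}. c k * m k r) + c0 * m k0 r"
        by (simp add: m'_def c0_def algebra_simps sum_subtractf sum_distrib_left sum_divide_distrib)
      then show ?thesis using c that split by (simp add: add.commute)
    qed
    moreover have "(\<Sum>k\<in>T. c' k * m k s) = 0"
      using split k0 by (simp add: c0_def)
    moreover have "\<exists>k\<in>T. c' k \<noteq> 0" using c(1) by (auto simp: c'_def)
    ultimately show ?thesis by blast
  qed
qed

section \<open>Dimension counting in the quotient\<close>

context highwater_ideal
begin

text \<open>The coordinates over \<open>W\<close> of the axes in \<open>T\<close> give one equation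
  per element of \<open>W\<close>. With more unknowns than equations, a nontrivial solution would be
  a dependence modulo \<open>I\<close>.\<close>

lemma spanning_card:
  assumes "finite T" "finite W" and indep: "\<And>c. acomb c T \<in> I \<Longrightarrow> \<forall>i\<in>T. c i = 0"
    and "\<And>k. reducible W (av k)"
  shows "card T \<le> card W"
proof (rule ccontr)
  assume "\<not> card T \<le> card W"
  obtain m where m: "\<And>k. (\<lambda>z. av k z - acomb (m k) W z) \<in> I"
    using assms(4) unfolding reducible_def by metis
  obtain d where d: "\<exists>k\<in>T. d k \<noteq> 0" "\<forall>s\<in>W. (\<Sum>k\<in>T. d k * m k s) = 0"
    using homogeneous_system_nontrivial[of W T m] assms(1,2) \<open>\<not> card T \<le> card W\<close> by auto
  have "(\<lambda>z. \<Sum>k\<in>T. d k * (av k z - acomb (m k) W z)) \<in> I"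
    by (rule sum_mem) (rule m)
  also have "(\<lambda>z. \<Sum>k\<in>T. d k * (av k z - acomb (m k) W z)) =
      (\<lambda>z. acomb d T z - (\<Sum>s\<in>W. (\<Sum>k\<in>T. d k * m k s) * av s z))"
    by (simp add: acomb_def algebra_simps sum_subtractf sum_distrib_left sum_distrib_right sum.swap[of _ T W])
  also have "\<dots> = acomb d T" using d(2) by simp
  finally show False using indep d(1) by blast
qed

text \<open>A dependence would allow one axis to be dropped, leaving fewer than \<open>D\<close>
  axes that still span, against \<open>spanning_card\<close>.\<close>

lemma window_independent:
  assumes "axial_codim I D" "finite W" "card W \<le> D" "\<And>k. reducible W (av k)"
    and c: "acomb c W \<in> I"
  shows "\<forall>i\<in>W. c i = 0"
proof (rule ccontr)
  assume "\<not> (\<forall>i\<in>W. c i = 0)"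
  then obtain p where p: "p \<in> W" "c p \<noteq> 0" by auto
  have sub: "reducible (W - {p}) (av i)" if "i \<in> W" for i
  proof (cases "i = p")
    case True
    have "reducible (W - {p}) (av (id p))"
      by (rule reducible_isolate[of W c id])
        (use p c assms(2) in \<open>auto simp: axis_comb_def acomb_def intro!: reducible_av\<close>)
    then show ?thesis using True by simp
  qed (use that assms(2) in \<open>auto intro: reducible_av\<close>)
  have "reducible (W - {p}) (av k)" for k
  proof -
    obtain e where "(\<lambda>z. av k z - acomb e W z) \<in> I"
      using assms(4)[of k] unfolding reducible_def by auto
    moreover have "reducible (W - {p}) (acomb e W)"
      unfolding acomb_def by (rule reducible_sum) (rule sub)
    ultimately show ?thesis by (rule reducible_diff_mem[rotated])
  qed
  moreover obtain T where "finite T" "card T = D" "\<And>c. acomb c T \<in> I \<Longrightarrow> \<forall>i\<in>T. c i = 0"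
    using assms(1) unfolding axial_codim_def by blast
  ultimately have "D \<le> card (W - {p})"
    using spanning_card[of T "W - {p}"] assms(2) by auto
  then show False using p assms(2,3) by (metis card_Diff1_less leD order.trans)
qed

end

section \<open>An ideal with a prescribed pattern\<close>

lemma basis_invalid_eq_0:
  assumes "\<not> valid_idx z"
  shows "av i z = 0" "sv j z = 0" "pv r k z = 0" "zv r k z = 0"
proof -
  have d: "hdelta x z = 0" if "valid_idx x" for x
    using that assms by (auto simp: hdelta_def)
  show "av i z = 0" "sv j z = 0" by (simp_all add: av_def sv_def hzero_def d)
  show p: "pv r k z = 0" for r k by (simp add: pv_def hzero_def hadd_def hsc_def d)
  show "zv r k z = 0" by (simp add: zv_def hadd_def hsc_def p)
qed

lemma mb_invalid_eq_0:
  assumes "\<not> valid_idx z"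
  shows "mb x y z = 0"
  by (cases "(x, y)" rule: mb.cases)
    (simp_all add: basis_invalid_eq_0[OF assms] mb_AA_def mb_AS_def mb_AP_def mb_SS_def mb_SP_def mb_PP_def)

lemma hmult_carrier:
  assumes "u \<in> Hcarrier" "v \<in> Hcarrier"
  shows "hmult u v \<in> Hcarrier"
proof -
  have "finite (supp (hmult u v))"
    using assms by (simp add: Hcarrier_def finite_supp_hmult)
  moreover have "hmult u v z = 0" if "\<not> valid_idx z" for z
    by (simp add: hmult_def mb_invalid_eq_0[OF that])
  ultimately show ?thesis by (simp add: Hcarrier_def)
qed

text \<open>These functions are the linear functionals on the span of the axes that vanish on every
  translate of the pattern.\<close>

definition recurrent :: "nat \<Rightarrow> (nat \<Rightarrow> 'a::field) \<Rightarrow> (int \<Rightarrow> 'a) \<Rightarrow> bool" where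
  "recurrent D \<alpha> f \<longleftrightarrow> (\<forall>k. (\<Sum>i\<in>{0..D}. \<alpha> i * f (int i + k)) = 0)"

lemma recurrent_const: "sum \<alpha> {0..D} = 0 \<Longrightarrow> recurrent D \<alpha> (\<lambda>i. c)"
  by (simp add: recurrent_def sum_distrib_right[symmetric])

lemma recurrent_add: "recurrent D \<alpha> f \<Longrightarrow> recurrent D \<alpha> g \<Longrightarrow> recurrent D \<alpha> (\<lambda>i. f i + g i)"
  by (simp add: recurrent_def algebra_simps sum.distrib)

lemma recurrent_scale: "recurrent D \<alpha> f \<Longrightarrow> recurrent D \<alpha> (\<lambda>i. c * f i)"
  by (simp add: recurrent_def mult.left_commute[of _ c] sum_distrib_left[symmetric])

lemma recurrent_shift:
  assumes "recurrent D \<alpha> f" shows "recurrent D \<alpha> (\<lambda>i. f (m + i))"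
  unfolding recurrent_def
proof
  fix k
  show "(\<Sum>i\<in>{0..D}. \<alpha> i * f (m + (int i + k))) = 0"
    using assms[unfolded recurrent_def, rule_format, of "m + k"] by (simp add: algebra_simps)
qed

text \<open>Here the symmetry of an ideal-type tuple enters: reversing the summation turns the
  reflected relation into \<open>\<epsilon>\<close> times the relation at
  \<open>- int D - k\<close>.\<close>

lemma recurrent_reflect:
  assumes "ideal_type D \<alpha>" "recurrent D \<alpha> f" shows "recurrent D \<alpha> (\<lambda>i. f (- i))"
  unfolding recurrent_def
proof
  fix k
  obtain \<epsilon> where e: "\<And>i. i \<le> D \<Longrightarrow> \<alpha> i = \<epsilon> * \<alpha> (D - i)"
    using assms(1) unfolding ideal_type_def by blast
  have "(\<Sum>i\<in>{0..D}. \<alpha> i * f (- (int i + k))) = (\<Sum>i\<in>{0..D}. \<alpha> (D - i) * f (- (int (D - i) + k)))"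
    by (rule sum.reindex_bij_witness[of _ "\<lambda>i. D - i" "\<lambda>i. D - i"]) auto
  also have "\<dots> = (\<Sum>i\<in>{0..D}. \<epsilon> * (\<alpha> i * f (int i + (- int D - k))))"
  proof (rule sum.cong[OF refl])
    fix i assume "i \<in> {0..D}"
    then have "i \<le> D" by simp
    then have "- (int (D - i) + k) = int i + (- int D - k)" "\<alpha> (D - i) = \<epsilon> * \<alpha> i"
      using e[of "D - i"] by simp_all
    then show "\<alpha> (D - i) * f (- (int (D - i) + k)) = \<epsilon> * (\<alpha> i * f (int i + (- int D - k)))"
      by (simp only: mult.assoc)
  qed
  also have "\<dots> = 0"
    using assms(2) by (simp add: recurrent_def sum_distrib_left[symmetric])
  finally show "(\<Sum>i\<in>{0..D}. \<alpha> i * f (- (int i + k))) = 0" .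
qed

fun axis_weight :: "(int \<Rightarrow> 'a::field) \<Rightarrow> hidx \<Rightarrow> 'a" where
  "axis_weight f (HA i) = f i"
| "axis_weight f _ = 0"

fun s_weight :: "(int \<Rightarrow> 'a::field) \<Rightarrow> hidx \<Rightarrow> 'a" where
  "s_weight f (HS j) = f (int j) + f (- int j) - 2 * f 0"
| "s_weight f _ = 0"

text \<open>The ideal of the introduction, described by linear functionals that vanish on it; the subtracted
  \<open>2 * f 0\<close> in \<open>s_weight\<close> accounts for \<open>s\<^sub>0 = 0\<close>.\<close>

definition pattern_annihilator :: "nat \<Rightarrow> (nat \<Rightarrow> 'a::field) \<Rightarrow> 'a helt set" where
  "pattern_annihilator D \<alpha> = {v \<in> Hcarrier. \<forall>f. recurrent D \<alpha> f \<longrightarrow>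
     linfun (axis_weight f) v = 0 \<and> linfun (s_weight f) v = 0}"

lemma linfun_axis_weight_basis:
  "linfun (axis_weight f) (sv j) = 0" "linfun (axis_weight f) (pv r k) = 0"
  "linfun (axis_weight f) (zv r k) = 0"
  by (simp_all add: linfun_sv linfun_pv linfun_zv)

lemma linfun_s_weight_basis:
  "linfun (s_weight f) (sv j) = f (int j) + f (- int j) - 2 * f 0" "linfun (s_weight f) (pv r k) = 0"
  "linfun (s_weight f) (zv r k) = 0"
  by (simp_all add: linfun_sv linfun_pv linfun_zv)

section \<open>The weights pulled back along products\<close>

context
  assumes char2: "(2::'a::field) \<noteq> 0" and char3: "(3::'a) \<noteq> 0"
begin

text \<open>The pullback of a weight along multiplication by an axis is again a sum of two weights.
  The value at 0 subtracted in \<open>s_weight\<close> supplies the term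
  \<open>- (3/4) * f k\<close> of (H2).\<close>

lemma axis_weight_mb_HA:
  "linfun (axis_weight f) (mb (HA k) y) =
     axis_weight (\<lambda>i. 1/2 * f i + 1/2 * f k) y + s_weight (\<lambda>i. 3/8 * f (k + i)) (y :: hidx)"
  for f :: "int \<Rightarrow> 'a"
proof (cases y)
  case (HS j)
  have "linfun (axis_weight f) (mb_AS k j) = - (3/4) * f k + 3/8 * (f (k - int j) + f (k + int j))"
    by (simp add: mb_AS_def linfun_axis_weight_basis)
  moreover obtain h :: 'a where "2 * h = 1"
    and h: "1/2 = h" "3/2 = 3 * h" "5/2 = 5 * h" "1/4 = h * h" "3/4 = 3 * h * h"
      "3/8 = 3 * h * h * h"
    by (rule dyadic_fractions[OF char2 char3])
  ultimately show ?thesis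
    unfolding HS mb.simps axis_weight.simps s_weight.simps add_0_right h
      diff_conv_add_uminus by algebra
qed (simp_all add: mb_AA_def mb_AP_def linfun_axis_weight_basis add_divide_distrib)

text \<open>Since \<open>s_weight\<close> adds the values at both signs, the absolute value in (H1)
  disappears; for \<open>i = k\<close> the weight is 0, in accordance with
  \<open>sv 0\<close>.\<close>

lemma s_weight_mb_HA:
  "linfun (s_weight f) (mb (HA k) y) =
     axis_weight (\<lambda>i. f (i - k) + f (k - i) + - 2 * f 0) y + s_weight (\<lambda>i. 3/2 * f i) (y :: hidx)"
  for f :: "int \<Rightarrow> 'a"
proof (cases y)
  case (HA i)
  then show ?thesis
    by (simp add: mb_AA_def linfun_s_weight_basis ndist_def abs_if)
next
  case (HS j)
  have "linfun (s_weight f) (mb_AS k j) = 3/2 * (f (int j) + f (- int j) - 2 * f 0)"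
    by (simp add: mb_AS_def linfun_s_weight_basis)
  moreover obtain h :: 'a where "2 * h = 1"
    and h: "1/2 = h" "3/2 = 3 * h" "5/2 = 5 * h" "1/4 = h * h" "3/4 = 3 * h * h"
      "3/8 = 3 * h * h * h"
    by (rule dyadic_fractions[OF char2 char3])
  ultimately show ?thesis
    unfolding HS mb.simps axis_weight.simps s_weight.simps h by algebra
qed (simp_all add: mb_AP_def linfun_s_weight_basis)

lemma axis_weight_mb_HS:
  "linfun (axis_weight f) (mb (HS l) y) =
     axis_weight (\<lambda>i. - 3/4 * f i + 3/8 * (f (i - int l) + f (i + int l))) (y :: hidx)"
  for f :: "int \<Rightarrow> 'a"
  by (cases y) (simp_all add: mb_AS_def mb_SS_def mb_SP_def linfun_axis_weight_basis)

text \<open>The terms of (H4) in \<open>l\<close> alone come from the value at 0 that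
  \<open>s_weight\<close> subtracts.\<close>

lemma s_weight_mb_HS:
  "linfun (s_weight f) (mb (HS l) y) =
     axis_weight (\<lambda>i. 3/2 * (f (int l) + f (- int l) - 2 * f 0)) y
     + s_weight (\<lambda>i. 3/4 * f i + - (3/8) * (f (int l + i) + f (- int l + i))) (y :: hidx)"
  for f :: "int \<Rightarrow> 'a"
proof (cases y)
  case (HS j)
  have "f (int (ndist (int l) (int j))) + f (- int (ndist (int l) (int j))) = f (int l - int j) + f (- int l + int j)"
    by (simp add: ndist_def abs_if)
  then have "linfun (s_weight f) (mb_SS l j) = 3/4 * ((f (int l) + f (- int l) - 2 * f 0) + (f (int j) + f (- int j) - 2 * f 0))
      - 3/8 * ((f (int l - int j) + f (- int l + int j) - 2 * f 0) + (f (int l + int j) + f (- int l - int j) - 2 * f 0))"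
    by (simp add: mb_SS_def linfun_s_weight_basis)
  moreover obtain h :: 'a where "2 * h = 1"
    and h: "1/2 = h" "3/2 = 3 * h" "5/2 = 5 * h" "1/4 = h * h" "3/4 = 3 * h * h"
      "3/8 = 3 * h * h * h"
    by (rule dyadic_fractions[OF char2 char3])
  ultimately show ?thesis
    unfolding HS mb.simps axis_weight.simps s_weight.simps add_0_right h
      diff_conv_add_uminus by algebra
qed (simp_all add: mb_AS_def mb_SS_def mb_SP_def linfun_s_weight_basis)

text \<open>The right-hand sides of (H3), (H5) and (H6) involve only \<open>p\<close> and
  \<open>z\<close>, which both weights kill.\<close>

lemma weight_mb_HP:
  "linfun (axis_weight f) (mb (HP1 k) y) = 0" "linfun (axis_weight f) (mb (HP2 k) y) = 0"
  "linfun (s_weight f) (mb (HP1 k) y) = 0" "linfun (s_weight f) (mb (HP2 k) y) = 0"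
  for f :: "int \<Rightarrow> 'a"
  by (cases y; simp add: mb_AP_def mb_SP_def mb_PP_def linfun_axis_weight_basis linfun_s_weight_basis)+

text \<open>Pulled back along a product, the weights of a recurrent \<open>f\<close> become weights
  of functions built from \<open>f\<close> by shifts, reflections, scalars and constants. These stay
  recurrent: constants because the coefficient sum is 0, reflections by the symmetry of
  \<open>\<alpha>\<close>.\<close>

lemma pattern_annihilator_ideal:
  assumes \<alpha>: "ideal_type D (\<alpha> :: nat \<Rightarrow> 'a)"
  shows "is_ideal (pattern_annihilator D \<alpha>)"
proof -
  let ?I = "pattern_annihilator D \<alpha>"
  note rec_intros = recurrent_const recurrent_add recurrent_scale
  have sum0: "sum \<alpha> {0..D} = 0" using \<alpha> unfolding ideal_type_def by blast
  have fin: "finite (supp v)" if "v \<in> Hcarrier" for v :: "'a helt"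
    using that by (simp add: Hcarrier_def)
  have "hmult v u \<in> ?I" if u: "u \<in> ?I" and v: "v \<in> Hcarrier" for u v
  proof -
    have uc: "u \<in> Hcarrier" using u by (simp add: pattern_annihilator_def)
    have u0: "linfun (axis_weight f) u = 0" "linfun (s_weight f) u = 0" if "recurrent D \<alpha> f" for f
      using u that by (simp_all add: pattern_annihilator_def)
    have u0': "linfun (axis_weight f) u + linfun (s_weight g) u = 0"
      if "recurrent D \<alpha> f" "recurrent D \<alpha> g" for f g
      using u0(1)[OF that(1)] u0(2)[OF that(2)] by simp
    have "linfun (axis_weight f) (hmult v u) = 0 \<and> linfun (s_weight f) (hmult v u) = 0"
      if f: "recurrent D \<alpha> f" for f
    proof -
      have f_plus: "recurrent D \<alpha> (\<lambda>i. f (k + i))" for k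
        by (rule recurrent_shift[OF f])
      have f_minus: "recurrent D \<alpha> (\<lambda>i. f (i - k))" "recurrent D \<alpha> (\<lambda>i. f (i + k))" for k
        using recurrent_shift[OF f, of "- k"] recurrent_shift[OF f, of k] by (simp_all add: add.commute)
      have f_refl: "recurrent D \<alpha> (\<lambda>i. f (k - i))" for k
        using recurrent_reflect[OF \<alpha> recurrent_shift[OF f, of k]] by simp
      \<comment> \<open>By \<open>linfun_hmult\<close> it is enough to treat basis elements
        \<open>x\<close> as the first factor.\<close>
      have "linfun (\<lambda>y. linfun (axis_weight f) (mb x y)) u = 0" for x
      proof (cases x)
        case (HA k)
        show ?thesis unfolding HA axis_weight_mb_HA linfun_add_left
          by (intro u0' rec_intros f f_plus sum0)
      next
        case (HS l)
        show ?thesis unfolding HS axis_weight_mb_HS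
          by (intro u0 rec_intros f f_minus sum0)
      qed (simp_all add: weight_mb_HP)
      moreover have "linfun (\<lambda>y. linfun (s_weight f) (mb x y)) u = 0" for x
      proof (cases x)
        case (HA k)
        show ?thesis unfolding HA s_weight_mb_HA linfun_add_left
          by (intro u0' rec_intros f f_minus f_refl sum0)
      next
        case (HS l)
        show ?thesis unfolding HS s_weight_mb_HS linfun_add_left
          by (intro u0' rec_intros f f_plus sum0)
      qed (simp_all add: weight_mb_HP)
      ultimately show ?thesis
        using fin[OF uc] fin[OF v] by (simp add: linfun_hmult)
    qed
    then show ?thesis
      using hmult_carrier[OF v uc] by (simp add: pattern_annihilator_def)
  qed
  moreover have "hadd u v \<in> ?I" if "u \<in> ?I" "v \<in> ?I" for u v
    using that by (auto simp: pattern_annihilator_def hadd_def Hcarrier_def)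
  moreover have "hsc c u \<in> ?I" if "u \<in> ?I" for c u
    using that by (auto simp: pattern_annihilator_def hsc_def Hcarrier_def)
  moreover have "hzero \<in> ?I"
    by (auto simp: pattern_annihilator_def hzero_def Hcarrier_def)
  moreover have "?I \<subseteq> Hcarrier" by (auto simp: pattern_annihilator_def)
  ultimately show ?thesis by (simp add: is_ideal_def)
qed

end

section \<open>Two-sided solutions of the recurrence\<close>

function forward_solution :: "nat \<Rightarrow> (nat \<Rightarrow> 'a::field) \<Rightarrow> (nat \<Rightarrow> 'a) \<Rightarrow> nat \<Rightarrow> 'a" where
  "forward_solution D \<alpha> c n = (if n < D then c n
     else - (\<Sum>i\<in>{0..<D}. \<alpha> i * forward_solution D \<alpha> c (n - D + i)) / \<alpha> D)"
  by auto
termination by (relation "measure (\<lambda>(D, \<alpha>, c, n). n)") auto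

declare forward_solution.simps [simp del]

lemma forward_solution_init: "n < D \<Longrightarrow> forward_solution D \<alpha> c n = c n"
  by (subst forward_solution.simps) simp

lemma forward_solution_rec:
  assumes "\<alpha> D \<noteq> 0"
  shows "(\<Sum>i\<in>{0..D}. \<alpha> i * forward_solution D \<alpha> c (n + i)) = 0"
proof -
  have "forward_solution D \<alpha> c (n + D) = - (\<Sum>i\<in>{0..<D}. \<alpha> i * forward_solution D \<alpha> c (n + i)) / \<alpha> D"
    by (subst forward_solution.simps) simp
  then show ?thesis using assms
    by (simp add: atLeastLessThanSuc_atLeastAtMost[symmetric])
qed

text \<open>\<open>g\<close> continues the initial values to the right by dividing by
  \<open>\<alpha> D\<close>; \<open>h\<close> solves the reversed recurrence, dividing by
  \<open>\<alpha> 0\<close>, and is read backwards from \<open>D - 1\<close>.\<close>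

lemma recurrent_init_exists:
  assumes ends: "\<alpha> 0 \<noteq> 0" "\<alpha> D \<noteq> 0"
  shows "\<exists>f. recurrent D \<alpha> f \<and> (\<forall>i<D. f (int i) = c i)"
proof -
  define g where "g = forward_solution D \<alpha> c"
  define h where "h = forward_solution D (\<lambda>i. \<alpha> (D - i)) (\<lambda>i. c (D - 1 - i))"
  define f where "f k = (if k \<ge> 0 then g (nat k) else h (nat (int D - 1 - k)))" for k
  \<comment> \<open>Both solutions agree on the initial window, so a relation starting at a negative
    \<open>k\<close>, whose last index is below \<open>D\<close>, lies entirely in the range of
    \<open>h\<close>.\<close>
  have h_eq: "f k = h (nat (int D - 1 - k))" if "k < int D" for k
  proof (cases "k \<ge> 0")
    case True
    with that have "nat k < D" "nat (int D - 1 - k) < D" "D - 1 - nat (int D - 1 - k) = nat k" by auto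
    then show ?thesis using True by (simp add: f_def g_def h_def forward_solution_init)
  qed (simp add: f_def)
  have "(\<Sum>i\<in>{0..D}. \<alpha> i * f (int i + k)) = 0" for k
  proof (cases "k \<ge> 0")
    case True
    then have "f (int i + k) = g (nat k + i)" for i by (simp add: f_def nat_add_distrib add.commute)
    then show ?thesis using forward_solution_rec[of \<alpha> D c "nat k"] ends by (simp add: g_def)
  next
    case False
    have "(\<Sum>i\<in>{0..D}. \<alpha> i * f (int i + k)) = (\<Sum>i\<in>{0..D}. \<alpha> (D - i) * f (int (D - i) + k))"
      by (rule sum.reindex_bij_witness[of _ "\<lambda>i. D - i" "\<lambda>i. D - i"]) auto
    also have "\<dots> = (\<Sum>i\<in>{0..D}. \<alpha> (D - i) * h (nat (- 1 - k) + i))"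
    proof (rule sum.cong[OF refl])
      fix i assume "i \<in> {0..D}"
      then have "int (D - i) + k < int D" "nat (int D - 1 - (int (D - i) + k)) = nat (- 1 - k) + i"
        using False by auto
      then show "\<alpha> (D - i) * f (int (D - i) + k) = \<alpha> (D - i) * h (nat (- 1 - k) + i)"
        by (simp only: h_eq)
    qed
    also have "\<dots> = 0"
      unfolding h_def by (rule forward_solution_rec) (use ends in simp)
    finally show ?thesis .
  qed
  moreover have "\<forall>i<D. f (int i) = c i"
    by (simp add: f_def g_def forward_solution_init)
  ultimately show ?thesis unfolding recurrent_def by blast
qed

section \<open>Patterns and minimal ideals\<close>

lemma pat_vec_axis_comb: "pat_vec D \<alpha> = axis_comb \<alpha> int {0..D}"
  by (simp add: pat_vec_def axis_comb_def)

lemma pat_vec_acomb: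
  assumes "\<gamma> D = 0"
  shows "pat_vec D \<gamma> = acomb (\<lambda>k. \<gamma> (nat k)) {0..<int D}"
proof -
  have "{0..<int D} = int ` {0..<D}" by (simp add: image_int_atLeastLessThan)
  then show ?thesis
    unfolding pat_vec_def acomb_def using assms
    by (simp add: sum.reindex atLeastLessThanSuc_atLeastAtMost[symmetric])
qed

section \<open>Uniqueness and symmetry of patterns\<close>

context highwater_ideal
begin

lemma axial_codim_proper:
  assumes "axial_codim I D" "D \<ge> 1"
  shows "\<exists>j. av j \<notin> I"
proof -
  obtain T where T: "finite T" "card T = D" "\<And>c. acomb c T \<in> I \<Longrightarrow> \<forall>i\<in>T. c i = 0"
    using assms(1) unfolding axial_codim_def by blast
  then obtain j where "j \<in> T" using assms(2) by fastforce
  have "av j \<notin> I"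
  proof
    assume "av j \<in> I"
    then have "\<forall>i\<in>T. (if i = j then 1 else 0) = (0 :: 'a)"
      using T(3)[of "\<lambda>i. if i = j then 1 else 0"] acomb_single[OF T(1) \<open>j \<in> T\<close>] by metis
    then show False using \<open>j \<in> T\<close> by auto
  qed
  then show ?thesis by blast
qed

lemma pattern_spans:
  assumes "av j \<notin> I" "\<alpha> 0 \<noteq> 0" "\<alpha> D \<noteq> 0" "pat_vec D \<alpha> \<in> I"
  shows "reducible {0..<int D} (av k)"
proof (rule window_spans[of \<alpha>])
  show "axis_comb \<alpha> (\<lambda>i. int i + m) {0..D} \<in> I" for m
    by (rule shift_mem) (use assms in \<open>simp_all add: pat_vec_axis_comb\<close>)
qed (use assms in auto)

lemma axial_codim_window:
  assumes "\<And>c. acomb c {0..<int D} \<in> I \<Longrightarrow> \<forall>i\<in>{0..<int D}. c i = 0"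
    and "\<And>k. reducible {0..<int D} (av k)"
  shows "axial_codim I D"
  unfolding axial_codim_def
  using assms by (intro exI[of _ "{0..<int D}"]) (simp add: reducible_def hadd_def hsc_def)

text \<open>Shifts of the pattern show that the \<open>D\<close> axes of the window span a space of
  dimension \<open>D\<close>, so they form a basis.\<close>

lemma has_pattern_independent:
  assumes pat: "has_pattern I D \<alpha>" and "D \<ge> 1" and "acomb c {0..<int D} \<in> I"
  shows "\<forall>i\<in>{0..<int D}. c i = 0"
proof (rule window_independent[OF _ _ _ _ assms(3)])
  show codim: "axial_codim I D" using pat by (simp add: has_pattern_def)
  obtain j where "av j \<notin> I" using axial_codim_proper[OF codim \<open>D \<ge> 1\<close>] by blast
  then show "reducible {0..<int D} (av k)" for k
    using pat pattern_spans unfolding has_pattern_def by blast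
qed auto

text \<open>The degree argument: no nonzero combination in \<open>I\<close> fits into a window
  shorter than the pattern.\<close>

lemma has_pattern_eq_0:
  assumes "has_pattern I D \<alpha>" "D \<ge> 1" "pat_vec D \<gamma> \<in> I" "\<gamma> D = 0" "i \<le> D"
  shows "\<gamma> i = 0"
proof (cases "i = D")
  case False
  then have "int i \<in> {0..<int D}" using assms(5) by simp
  then have "\<gamma> (nat (int i)) = 0"
    using has_pattern_independent[OF assms(1,2)] assms(3) unfolding pat_vec_acomb[of \<gamma> D, OF assms(4)] by blast
  then show ?thesis by simp
qed (use assms in simp)

lemma pat_vec_comb_mem:
  assumes "pat_vec D \<alpha> \<in> I" "pat_vec D \<beta> \<in> I"
  shows "pat_vec D (\<lambda>i. a * \<alpha> i - b * \<beta> i) \<in> I"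
  using diff_mem[OF scale_mem[OF assms(1), of a] scale_mem[OF assms(2), of b]]
  by (simp add: pat_vec_def sum_distrib_left sum_subtractf algebra_simps)

lemma has_pattern_unique:
  assumes \<alpha>: "has_pattern I D \<alpha>" and \<beta>: "has_pattern I D \<beta>" and "D \<ge> 1"
  shows "\<exists>c. c \<noteq> 0 \<and> (\<forall>i\<le>D. \<beta> i = c * \<alpha> i)"
proof (intro exI conjI allI impI)
  show "\<beta> D / \<alpha> D \<noteq> 0" using \<alpha> \<beta> by (simp add: has_pattern_def)
  fix i assume "i \<le> D"
  \<comment> \<open>Cross-multiplying cancels the last coefficient.\<close>
  have "pat_vec D (\<lambda>i. \<beta> D * \<alpha> i - \<alpha> D * \<beta> i) \<in> I"
    using \<alpha> \<beta> by (intro pat_vec_comb_mem) (simp_all add: has_pattern_def)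
  then have "\<beta> D * \<alpha> i - \<alpha> D * \<beta> i = 0"
    using has_pattern_eq_0[OF \<alpha> \<open>D \<ge> 1\<close>, of "\<lambda>i. \<beta> D * \<alpha> i - \<alpha> D * \<beta> i" i] \<open>i \<le> D\<close> by simp
  then show "\<beta> i = \<beta> D / \<alpha> D * \<alpha> i"
    using \<alpha> by (simp add: has_pattern_def field_simps)
qed

text \<open>Reflecting about 0 and shifting by \<open>D\<close> puts the reversed pattern into
  \<open>I\<close>; eliminating the last coefficient shows it proportional to the pattern.\<close>

lemma has_pattern_ideal_type:
  assumes pat: "has_pattern I D \<alpha>" and "D \<ge> 1"
  shows "ideal_type D \<alpha>"
proof -
  have ends: "\<alpha> 0 \<noteq> 0" "\<alpha> D \<noteq> 0" and mem: "pat_vec D \<alpha> \<in> I"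
    using pat by (simp_all add: has_pattern_def)
  obtain j where j: "av j \<notin> I"
    using axial_codim_proper \<open>D \<ge> 1\<close> pat unfolding has_pattern_def by blast
  have x: "axis_comb \<alpha> int {0..D} \<in> I" using mem by (simp add: pat_vec_axis_comb)
  have sum0: "sum \<alpha> {0..D} = 0"
    by (rule augmentation_eq_0[OF _ x j]) simp
  have "axis_comb \<alpha> (\<lambda>i. 2 * 0 - int i + int D) {0..D} \<in> I"
    by (rule shift_mem[OF _ reflect_mem[OF _ x] j]) simp_all
  also have "axis_comb \<alpha> (\<lambda>i. 2 * 0 - int i + int D) {0..D} = pat_vec D (\<lambda>i. \<alpha> (D - i))"
    unfolding axis_comb_def pat_vec_def
    by (rule ext, rule sum.reindex_bij_witness[of _ "\<lambda>i. D - i" "\<lambda>i. D - i"]) (auto simp: of_nat_diff)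
  finally have rev: "pat_vec D (\<lambda>i. \<alpha> (D - i)) \<in> I" .
  have sym: "\<alpha> 0 * \<alpha> i = \<alpha> D * \<alpha> (D - i)" if "i \<le> D" for i
    using has_pattern_eq_0[OF pat \<open>D \<ge> 1\<close> pat_vec_comb_mem[OF mem rev, of "\<alpha> 0" "\<alpha> D"] _ that] by simp
  define \<epsilon> where "\<epsilon> = \<alpha> D / \<alpha> 0"
  \<comment> \<open>At \<open>i = 0\<close> the symmetry reads as equality of the squares of the two
    end coefficients.\<close>
  have "\<epsilon> * \<epsilon> = 1" using sym[of 0] ends by (simp add: \<epsilon>_def field_simps)
  then have "\<epsilon> \<in> {1, -1}" by (simp add: square_eq_1_iff)
  moreover have "\<forall>i\<le>D. \<alpha> i = \<epsilon> * \<alpha> (D - i)"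
    using sym ends by (simp add: \<epsilon>_def field_simps)
  ultimately show ?thesis
    unfolding ideal_type_def using ends sum0 by blast
qed

end

section \<open>The ideal generated by a pattern\<close>

lemma ideal_gen_least: "is_ideal I \<Longrightarrow> v \<in> I \<Longrightarrow> ideal_gen v \<subseteq> I"
  by (auto simp: ideal_gen_def)

lemma mem_ideal_gen: "v \<in> ideal_gen v"
  by (simp add: ideal_gen_def)

text \<open>The given ideal keeps the intersected family nonempty, hence the intersection inside
  \<open>Hcarrier\<close>.\<close>

lemma is_ideal_ideal_gen:
  assumes "is_ideal I" "v \<in> I"
  shows "is_ideal (ideal_gen v)"
proof -
  have "ideal_gen v \<subseteq> Hcarrier"
    using ideal_gen_least[OF assms] assms(1) by (auto simp: is_ideal_def)
  then show ?thesis
    unfolding is_ideal_def[of "ideal_gen v"] by (auto simp: ideal_gen_def is_ideal_def)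
qed

lemma pat_vec_carrier: "pat_vec D \<alpha> \<in> Hcarrier"
  by (auto simp: Hcarrier_def pat_vec_def basis_invalid_eq_0)

lemma pat_vec_annihilator: "pat_vec D \<alpha> \<in> pattern_annihilator D \<alpha>"
proof -
  have "linfun (axis_weight f) (pat_vec D \<alpha>) = 0 \<and> linfun (s_weight f) (pat_vec D \<alpha>) = 0"
    if "recurrent D \<alpha> f" for f
    using that[unfolded recurrent_def, rule_format, of 0] by (simp add: pat_vec_def)
  then show ?thesis by (simp add: pattern_annihilator_def pat_vec_carrier)
qed

text \<open>The recurrent function that is 1 at \<open>p\<close> and 0 elsewhere on the window reads
  off the coefficient \<open>c p\<close>.\<close>

lemma annihilator_independent:
  assumes "\<alpha> 0 \<noteq> 0" "\<alpha> D \<noteq> 0" "acomb c {0..<int D} \<in> pattern_annihilator D \<alpha>"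
  shows "\<forall>i\<in>{0..<int D}. c i = 0"
proof
  fix p assume p: "p \<in> {0..<int D}"
  obtain f where f: "recurrent D \<alpha> f" "\<And>i. i < D \<Longrightarrow> f (int i) = (if i = nat p then 1 else 0)"
    using recurrent_init_exists[OF assms(1,2), of "\<lambda>i. if i = nat p then 1 else 0"] by blast
  have f': "f i = (if i = p then 1 else 0)" if "i \<in> {0..<int D}" for i
    using f(2)[of "nat i"] that p by (auto split: if_splits)
  have "0 = linfun (axis_weight f) (acomb c {0..<int D})"
    using assms(3) f(1) by (simp add: pattern_annihilator_def)
  also have "\<dots> = (\<Sum>i\<in>{0..<int D}. c i * f i)"
    by (simp add: acomb_def)
  also have "\<dots> = (\<Sum>i\<in>{0..<int D}. if i = p then c i else 0)"
    by (rule sum.cong) (simp_all add: f')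
  also have "\<dots> = c p" using p by simp
  finally show "c p = 0" by simp
qed

text \<open>The axial codimension is bounded from both sides: the window is independent modulo the
  larger ideal \<open>pattern_annihilator D \<alpha>\<close>, and it spans by shifts of the
  pattern.\<close>

lemma ideal_gen_has_pattern:
  assumes char2: "(2::'a::field) \<noteq> 0" and char3: "(3::'a) \<noteq> 0" and "D \<ge> 1"
    and \<alpha>: "ideal_type D (\<alpha> :: nat \<Rightarrow> 'a)"
  shows "is_ideal (ideal_gen (pat_vec D \<alpha>))" "has_pattern (ideal_gen (pat_vec D \<alpha>)) D \<alpha>"
proof -
  let ?J = "ideal_gen (pat_vec D \<alpha>)"
  have ends: "\<alpha> 0 \<noteq> 0" "\<alpha> D \<noteq> 0" using \<alpha> unfolding ideal_type_def by blast+
  note ann = pattern_annihilator_ideal[OF char2 char3 \<alpha>] pat_vec_annihilator[of D \<alpha>]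
  show ideal: "is_ideal ?J" by (rule is_ideal_ideal_gen[OF ann])
  interpret highwater_ideal ?J by unfold_locales (rule ideal char2 char3)+
  have indep: "\<forall>i\<in>{0..<int D}. c i = 0" if "acomb c {0..<int D} \<in> ?J" for c
    using annihilator_independent[OF ends] that ideal_gen_least[OF ann] by blast
  \<comment> \<open>Shifts are available only when some axis lies outside the ideal;
    \<open>av 0\<close> belongs to the window because \<open>D \<ge> 1\<close>.\<close>
  have "av 0 \<notin> ?J"
  proof
    assume "av 0 \<in> ?J"
    then have "acomb (\<lambda>k. if k = 0 then 1 else 0) {0..<int D} \<in> ?J"
      using \<open>D \<ge> 1\<close> by (simp add: acomb_single)
    from bspec[OF indep[OF this], of 0] show False using \<open>D \<ge> 1\<close> by simp
  qed
  from pattern_spans[OF this ends mem_ideal_gen] have "axial_codim ?J D"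
    by (intro axial_codim_window indep)
  then show "has_pattern ?J D \<alpha>"
    using ends by (simp add: has_pattern_def mem_ideal_gen)
qed

theorem theorem1p7:
  fixes D :: nat
  assumes char2: "(2::'a::field) \<noteq> 0" and char3: "(3::'a) \<noteq> 0"
    and D: "D \<ge> 1"
  shows "(\<forall>\<alpha> :: nat \<Rightarrow> 'a. ideal_type D \<alpha> \<longrightarrow> minimal_ideal (ideal_gen (pat_vec D \<alpha>)) D)
    \<and> (\<forall>\<alpha> \<beta> :: nat \<Rightarrow> 'a. ideal_type D \<alpha> \<and> ideal_type D \<beta> \<longrightarrow>
         (ideal_gen (pat_vec D \<alpha>) = ideal_gen (pat_vec D \<beta>) \<longleftrightarrow>
          (\<exists>c. c \<noteq> 0 \<and> (\<forall>i\<le>D. \<beta> i = c * \<alpha> i))))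
    \<and> (\<forall>I :: 'a helt set. minimal_ideal I D \<longrightarrow>
         (\<exists>\<alpha>. ideal_type D \<alpha> \<and> I = ideal_gen (pat_vec D \<alpha>)))"
proof (intro conjI allI impI)
  note gen = ideal_gen_has_pattern[OF char2 char3 D]
  fix \<alpha> :: "nat \<Rightarrow> 'a" assume \<alpha>: "ideal_type D \<alpha>"
  \<comment> \<open>An ideal with this pattern contains the generator, which gives the reverse
    inclusion.\<close>
  have "J = ideal_gen (pat_vec D \<alpha>)"
    if "is_ideal J" "has_pattern J D \<alpha>" "J \<subseteq> ideal_gen (pat_vec D \<alpha>)" for J
    using that ideal_gen_least[of J "pat_vec D \<alpha>"] unfolding has_pattern_def by blast
  then show "minimal_ideal (ideal_gen (pat_vec D \<alpha>)) D"
    unfolding minimal_ideal_def using gen[OF \<alpha>] has_pattern_def by blast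
next
  note gen = ideal_gen_has_pattern[OF char2 char3 D]
  fix \<alpha> \<beta> :: "nat \<Rightarrow> 'a" assume "ideal_type D \<alpha> \<and> ideal_type D \<beta>"
  then have \<alpha>: "ideal_type D \<alpha>" and \<beta>: "ideal_type D \<beta>" by auto
  let ?J = "\<lambda>\<alpha>. ideal_gen (pat_vec D \<alpha>)"
  \<comment> \<open>Used with \<open>c\<close> and with \<open>1 / c\<close>, this yields both
    inclusions.\<close>
  have sub: "?J \<delta> \<subseteq> ?J \<gamma>"
    if "ideal_type D \<gamma>" "\<forall>i\<le>D. \<delta> i = c * \<gamma> i" for \<gamma> \<delta> :: "nat \<Rightarrow> 'a" and c
  proof (rule ideal_gen_least[OF gen(1)[OF that(1)]])
    interpret highwater_ideal "?J \<gamma>"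
      by unfold_locales (rule gen(1)[OF that(1)] char2 char3)+
    have "pat_vec D \<delta> = (\<lambda>z. c * pat_vec D \<gamma> z)"
      using that(2) by (simp add: pat_vec_def sum_distrib_left mult.assoc)
    then show "pat_vec D \<delta> \<in> ?J \<gamma>" using scale_mem[OF mem_ideal_gen] by simp
  qed
  show "?J \<alpha> = ?J \<beta> \<longleftrightarrow> (\<exists>c. c \<noteq> 0 \<and> (\<forall>i\<le>D. \<beta> i = c * \<alpha> i))"
  proof
    assume eq: "?J \<alpha> = ?J \<beta>"
    interpret highwater_ideal "?J \<alpha>"
      by unfold_locales (rule gen(1)[OF \<alpha>] char2 char3)+
    \<comment> \<open>The common ideal has both patterns.\<close>
    show "\<exists>c. c \<noteq> 0 \<and> (\<forall>i\<le>D. \<beta> i = c * \<alpha> i)"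
      using has_pattern_unique[OF gen(2)[OF \<alpha>] _ D] gen(2)[OF \<beta>] eq by simp
  next
    assume "\<exists>c. c \<noteq> 0 \<and> (\<forall>i\<le>D. \<beta> i = c * \<alpha> i)"
    then obtain c where c: "c \<noteq> 0" "\<forall>i\<le>D. \<beta> i = c * \<alpha> i" by blast
    then have "\<forall>i\<le>D. \<alpha> i = 1 / c * \<beta> i" by simp
    with c(2) show "?J \<alpha> = ?J \<beta>" using sub[OF \<alpha>] sub[OF \<beta>] by blast
  qed
next
  fix I :: "'a helt set" assume I: "minimal_ideal I D"
  then obtain \<alpha> where pat: "has_pattern I D \<alpha>" and "is_ideal I"
    and min: "\<And>J. is_ideal J \<Longrightarrow> has_pattern J D \<alpha> \<Longrightarrow> J \<subseteq> I \<Longrightarrow> J = I"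
    unfolding minimal_ideal_def has_pattern_def by metis
  then interpret highwater_ideal I
    using char2 char3 by unfold_locales
  have \<alpha>: "ideal_type D \<alpha>" by (rule has_pattern_ideal_type[OF pat D])
  \<comment> \<open>The generated ideal has the same pattern and lies in \<open>I\<close>, so
    minimality forces equality.\<close>
  have "ideal_gen (pat_vec D \<alpha>) \<subseteq> I"
    using pat ideal by (intro ideal_gen_least) (simp_all add: has_pattern_def)
  then have "ideal_gen (pat_vec D \<alpha>) = I"
    using min ideal_gen_has_pattern[OF char2 char3 D \<alpha>] by blast
  then show "\<exists>\<alpha>. ideal_type D \<alpha> \<and> I = ideal_gen (pat_vec D \<alpha>)"
    using \<alpha> by blast
qed

end
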